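(* Suppose that at every step of the joint bidiagonalization (JBD) process the inner least squares problem is solved accurately. Then the quantities computed by the $k$-step JBD process in finite precision satisfy $$\eta(\widehat U_k)\le\|\widehat B_k^{-1}\|^2\big[\eta(\widetilde V_k)+2\eta(U_{k+1})+O(c_3(m,n,p)\epsilon)\big].$$
   Context: Setting. $A\in\mathbb{R}^{m\times n}$, $L\in\mathbb{R}^{p\times n}$ with $\mathrm{rank}\begin{pmatrix}A\\L\end{pmatrix}=n$. The compact QR factorization is $\begin{pmatrix}A\\L\end{pmatrix}=QR$ with $Q^TQ=I_n$, $Q\in\mathbb{R}^{(m+p)\times n}$, $R$ nonsingular. $\|\cdot\|$ is the 2-norm, $\epsilon$ is the unit roundoff, and $e_{k+1}$ is the last column of $I_{k+1}$. For a matrix $W_j$ with $j$ columns, the orthogonality level is $\eta(W_j)=\|I_j-W_j^TW_j\|$. JBD process (exact form). $\beta_1u_1=b$; $\alpha_1\tilde v_1=QQ^T(u_1^T,0_p^T)^T$; $\hat\alpha_1\hat u_1=\tilde v_1(m{+}1{:}m{+}p)$; and for $i\ge1$: $\beta_{i+1}u_{i+1}=\tilde v_i(1{:}m)-\alpha_iu_i$; $\alpha_{i+1}\tilde v_{i+1}=QQ^T(u_{i+1}^T,0_p^T)^T-\beta_{i+1}\tilde v_i$; $\hat\beta_i=\alpha_{i+1}\beta_{i+1}/\hat\alpha_i$; $\hat\alpha_{i+1}\hat u_{i+1}=(-1)^i\tilde v_{i+1}(m{+}1{:}m{+}p)-\hat\beta_i\hat u_i$. The vector $QQ^T(u_i^T,0_p^T)^T$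 is obtained by solving the inner least squares problem $\min_x\|\begin{pmatrix}A\\L\end{pmatrix}x-\begin{pmatrix}u_i\\0_p\end{pmatrix}\|$. Notation (computed quantities). $U_{k+1}=(u_1,\dots,u_{k+1})\in\mathbb{R}^{m\times(k+1)}$, $\widetilde V_k=(\tilde v_1,\dots,\tilde v_k)\in\mathbb{R}^{(m+p)\times k}$, $\widehat U_k=(\hat u_1,\dots,\hat u_k)\in\mathbb{R}^{p\times k}$; all these vectors have unit length. $B_k\in\mathbb{R}^{(k+1)\times k}$ is lower bidiagonal with diagonal $\alpha_1,\dots,\alpha_k$ and subdiagonal $\beta_2,\dots,\beta_{k+1}$. $\widehat B_k\in\mathbb{R}^{k\times k}$ is upper bidiagonal with diagonal $\hat\alpha_1,\dots,\hat\alpha_k$ and superdiagonal $\hat\beta_1,\dots,\hat\beta_{k-1}$, assumed invertible. $D_k=\mathrm{diag}(1,-1,\dots,(-1)^{k-1})$. Finite precision model (with accurate inner solves). The computed quantities satisfy $(I_m,0_{m\times p})\widetilde V_k=U_{k+1}B_k+\widetilde F_k$, $QQ^T\begin{pmatrix}U_{k+1}\\0_{p\times(k+1)}\end{pmatrix}=\widetilde V_kB_k^T+\alpha_{k+1}\tilde v_{k+1}e_{k+1}^T+\widetilde G_{k+1}$, $(0_{p\times m},I_p)\widetilde V_kD_k=\widehat U_k\widehat B_k+\bar F_k$, with $\|\widetilde F_k\|,\|\widetilde G_{k+1}\|,\|\bar F_k\|=O(\epsilon)$. The computed scalar $\hat\beta_i$ is $(\alpha_{i+1}\beta_{i+1}/\hat\alpha_i)(1+\rho_i)$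 with $|\rho_i|=O(\epsilon)$. Local orthogonality: $\beta_{i+1}|u_{i+1}^Tu_i|=O(c_1\epsilon)$ and $\hat\alpha_{i+1}|\hat u_{i+1}^T\hat u_i|=O(c_2\epsilon)$, with modest constants $c_1=c_1(m,n)$, $c_2=c_2(p,n)$ (taken $\ge1$); no $\beta_{i+1}$ or $\hat\alpha_{i+1}$ is negligible. $c_3(m,n,p)=c_1(m,n)+c_2(p,n)$. Convention. $X=O(Y)$ means $|X|\le KY$ for a modest constant $K$ that does not depend on $\epsilon$ or on $\|\widehat B_k^{-1}\|$ (it may depend on $k$), with $\epsilon$ sufficiently small. *)

theory Defs
  imports
    Complex_Main
    "Jordan_Normal_Form.Matrix"
    "Jordan_Normal_Form.Gauss_Jordan_Elimination"
    "Jordan_Normal_Form.DL_Rank"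
begin

definition l2_norm :: "real vec \<Rightarrow> real" where
  "l2_norm x = sqrt (x \<bullet> x)"

text \<open>The spectral norm. The supremum is over the whole unit ball rather than the unit sphere, so
  that it is also the supremum of a nonempty set for a matrix without columns.\<close>

definition mat_norm2 :: "real mat \<Rightarrow> real" where
  "mat_norm2 M = Sup {l2_norm (M *\<^sub>v x) | x. x \<in> carrier_vec (dim_col M) \<and> l2_norm x \<le> 1}"

definition orth_level :: "real mat \<Rightarrow> real" where
  "orth_level W = mat_norm2 (1\<^sub>m (dim_col W) - W\<^sup>T * W)"

text \<open>Meaningful for invertible matrices only.\<close>

definition mat_inv :: "real mat \<Rightarrow> real mat" where
  "mat_inv M = the (mat_inverse M)"

definition compact_qr :: "nat \<Rightarrow> nat \<Rightarrow> real mat \<Rightarrow> real mat \<Rightarrow> real mat \<Rightarrow> bool" where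
  "compact_qr r n M Q R \<longleftrightarrow>
     M \<in> carrier_mat r n \<and> Q \<in> carrier_mat r n \<and> R \<in> carrier_mat n n \<and>
     Q\<^sup>T * Q = 1\<^sub>m n \<and> upper_triangular R \<and> invertible_mat R \<and> M = Q * R"

text \<open>Families of vectors and scalars are indexed from 1, as in the mathematical notation, whereas
  matrix entries are indexed from 0.\<close>

definition first_cols :: "nat \<Rightarrow> nat \<Rightarrow> (nat \<Rightarrow> real vec) \<Rightarrow> real mat" where
  "first_cols d j w = mat_of_cols d (map w [1..<Suc j])"

text \<open>Size \<open>(k+1) \<times> k\<close>: diagonal \<open>\<alpha>\<^sub>1, \<dots>, \<alpha>\<^sub>k\<close>,
  subdiagonal \<open>\<beta>\<^sub>2, \<dots>, \<beta>\<^sub>k\<^sub>+\<^sub>1\<close>.\<close>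

definition lower_bidiag :: "nat \<Rightarrow> (nat \<Rightarrow> real) \<Rightarrow> (nat \<Rightarrow> real) \<Rightarrow> real mat" where
  "lower_bidiag k \<alpha> \<beta> = mat (k + 1) k
     (\<lambda>(i, j). if i = j then \<alpha> (j + 1) else if i = j + 1 then \<beta> (j + 2) else 0)"

text \<open>Size \<open>k \<times> k\<close>: diagonal \<open>\<alpha>\<^sub>1, \<dots>, \<alpha>\<^sub>k\<close>,
  superdiagonal \<open>\<beta>\<^sub>1, \<dots>, \<beta>\<^sub>k\<^sub>-\<^sub>1\<close>.\<close>

definition upper_bidiag :: "nat \<Rightarrow> (nat \<Rightarrow> real) \<Rightarrow> (nat \<Rightarrow> real) \<Rightarrow> real mat" where
  "upper_bidiag k \<alpha> \<beta> = mat k k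
     (\<lambda>(i, j). if i = j then \<alpha> (i + 1) else if j = i + 1 then \<beta> (i + 1) else 0)"

definition alt_diag :: "nat \<Rightarrow> real mat" where
  "alt_diag k = mat_diag k (\<lambda>i. (- 1) ^ i)"

definition outer_prod :: "real vec \<Rightarrow> real vec \<Rightarrow> real mat" where
  "outer_prod x y = mat_of_cols (dim_vec x) [x] * mat_of_rows (dim_vec y) [y]"

definition c3 :: "(nat \<Rightarrow> nat \<Rightarrow> real) \<Rightarrow> (nat \<Rightarrow> nat \<Rightarrow> real) \<Rightarrow> nat \<Rightarrow> nat \<Rightarrow> nat \<Rightarrow> real" where
  "c3 c1 c2 m n p = c1 m n + c2 p n"

text \<open>The quantities computed by the \<open>k\<close>-step JBD process with unit roundoff \<open>eps\<close> when
  every inner least squares problem is solved accurately: the error \<open>G\<close> in \<open>QQ\<^sup>T(U; 0)\<close>, whose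
  columns are \<open>(A; L) x\<close> for the exact least squares solutions \<open>x\<close>, is then of the order of \<open>eps\<close>. The vectors \<open>uh i\<close> and
  scalars \<open>\<alpha>h i\<close>, \<open>\<beta>h i\<close> are the hatted ones, and \<open>v i\<close> are the vectors of length \<open>m + p\<close>.
  All bounds \<open>O(eps)\<close> of the model are stated with one common constant \<open>C\<close>.
  Positivity of \<open>\<beta> (i+1)\<close> and \<open>\<alpha>h (i+1)\<close> is all that is kept of the requirement that they are not
  negligible: no particular threshold is imposed.\<close>

locale computed_jbd =
  fixes C :: real and c1 c2 :: "nat \<Rightarrow> nat \<Rightarrow> real" and m n p k :: nat and eps :: real
    and A L Q R :: "real mat"
    and u v uh :: "nat \<Rightarrow> real vec"
    and \<alpha> \<beta> \<alpha>h \<beta>h :: "nat \<Rightarrow> real"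
  assumes A_dim: "A \<in> carrier_mat m n"
    and L_dim: "L \<in> carrier_mat p n"
    and rank_AL: "vec_space.rank (m + p) (A @\<^sub>r L) = n"
    and qr: "compact_qr (m + p) n (A @\<^sub>r L) Q R"
    and u_unit: "\<And>i. i \<in> {1..k + 1} \<Longrightarrow> u i \<in> carrier_vec m \<and> l2_norm (u i) = 1"
    and v_unit: "\<And>i. i \<in> {1..k} \<Longrightarrow> v i \<in> carrier_vec (m + p) \<and> l2_norm (v i) = 1"
    and v_last: "v (k + 1) \<in> carrier_vec (m + p)"
    and uh_unit: "\<And>i. i \<in> {1..k} \<Longrightarrow> uh i \<in> carrier_vec p \<and> l2_norm (uh i) = 1"
    and Bh_invertible: "invertible_mat (upper_bidiag k \<alpha>h \<beta>h)"
    and rel_F: "\<exists>F \<in> carrier_mat m k. mat_norm2 F \<le> C * eps \<and>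
        (1\<^sub>m m @\<^sub>r 0\<^sub>m p m)\<^sup>T * first_cols (m + p) k v
          = first_cols m (k + 1) u * lower_bidiag k \<alpha> \<beta> + F"
    and rel_G: "\<exists>G \<in> carrier_mat (m + p) (k + 1). mat_norm2 G \<le> C * eps \<and>
        Q * Q\<^sup>T * (first_cols m (k + 1) u @\<^sub>r 0\<^sub>m p (k + 1))
          = first_cols (m + p) k v * (lower_bidiag k \<alpha> \<beta>)\<^sup>T
            + \<alpha> (k + 1) \<cdot>\<^sub>m outer_prod (v (k + 1)) (unit_vec (k + 1) k) + G"
    and rel_Fbar: "\<exists>Fbar \<in> carrier_mat p k. mat_norm2 Fbar \<le> C * eps \<and>
        (0\<^sub>m m p @\<^sub>r 1\<^sub>m p)\<^sup>T * first_cols (m + p) k v * alt_diag k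
          = first_cols p k uh * upper_bidiag k \<alpha>h \<beta>h + Fbar"
    and beta_hat: "\<And>i. i \<in> {1..<k} \<Longrightarrow>
        \<exists>\<rho>. \<bar>\<rho>\<bar> \<le> C * eps \<and> \<beta>h i = \<alpha> (i + 1) * \<beta> (i + 1) / \<alpha>h i * (1 + \<rho>)"
    and local_orth_u: "\<And>i. i \<in> {1..k} \<Longrightarrow> \<beta> (i + 1) * \<bar>u (i + 1) \<bullet> u i\<bar> \<le> C * (c1 m n * eps)"
    and local_orth_uh: "\<And>i. i \<in> {1..<k} \<Longrightarrow> \<alpha>h (i + 1) * \<bar>uh (i + 1) \<bullet> uh i\<bar> \<le> C * (c2 p n * eps)"
    and beta_pos: "\<And>i. i \<in> {1..k} \<Longrightarrow> 0 < \<beta> (i + 1)"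
    and alpha_hat_pos: "\<And>i. i \<in> {1..<k} \<Longrightarrow> 0 < \<alpha>h (i + 1)"

end

theory Submission
  imports Defs "HOL-Analysis.L2_Norm"
begin

text \<open>Write \<open>D\<close> for the diagonal sign matrix, \<open>B\<close> for the lower bidiagonal matrix times \<open>D\<close>, \<open>H\<close> for the upper
  bidiagonal matrix, \<open>W\<close> for the matrix of hatted vectors and \<open>V\<close> for the matrix of the long vectors. The
  upper and lower row blocks of \<open>V D\<close> are \<open>U B\<close> and \<open>W H\<close> up to errors of order \<open>eps\<close>. Adding their Gram
  matrices gives the Gram matrix of \<open>V D\<close>, that is

  \<open>D V\<^sup>T V D = B\<^sup>T U\<^sup>T U B + H\<^sup>T W\<^sup>T W H + O(eps)\<close>.

  If all three families were orthonormal, this would be the relation \<open>I = B\<^sup>T B + H\<^sup>T H\<close> up to rounding.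
  With its residual \<open>E = B\<^sup>T B + H\<^sup>T H - I\<close>, subtracting the computed relation from the ideal one yields

  \<open>H\<^sup>T (I - W\<^sup>T W) H = D (I - V\<^sup>T V) D - B\<^sup>T (I - U\<^sup>T U) B + E + O(eps)\<close>,

  so the loss of orthogonality of \<open>W\<close> is that of \<open>V\<close> plus at most \<open>\<parallel>B\<parallel>\<^sup>2\<close> times that of \<open>U\<close>, plus the norm of \<open>E\<close>
  and a rounding term, all multiplied by the square of the norm of the inverse of \<open>H\<close>. This
  argument is the lemma \<open>orth_defect_transfer\<close>, followed by \<open>orth_level_le_inverse\<close>.

  It remains to see that \<open>E\<close> is small, which is \<open>gram_error_entry_le\<close>. The matrix \<open>E\<close> is tridiagonal. Its
  diagonal is small because the long vectors have length one and consecutive short vectors are nearly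
  orthogonal (\<open>two_term_norm_defect\<close>); this is where \<open>c1 + c2\<close> enters. Its off-diagonal entries are
  small because \<open>\<beta>h\<close> is computed from the exact formula up to a small relative error, so that the
  off-diagonal entries of \<open>B\<^sup>T B\<close> and \<open>H\<^sup>T H\<close> cancel. Smallness of \<open>E\<close> is used a second time: as
  \<open>B\<^sup>T B \<le> I + E\<close>, it forces \<open>\<parallel>B\<parallel>\<^sup>2 \<le> 2\<close> once \<open>eps\<close> is small enough, and this is the factor \<open>2\<close> in the claim.\<close>

section \<open>The Euclidean norm and the spectral norm\<close>

lemma l2_norm_eq_L2_set: "l2_norm x = L2_set (\<lambda>i. x $ i) {0..<dim_vec x}"
  by (simp add: l2_norm_def L2_set_def scalar_prod_def power2_eq_square)

lemma l2_norm_nonneg [simp]: "0 \<le> l2_norm x"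
  by (simp add: l2_norm_eq_L2_set)

lemma l2_norm_squared: "(l2_norm x)\<^sup>2 = x \<bullet> x"
proof -
  have "0 \<le> x \<bullet> x"
    by (auto simp: scalar_prod_def intro!: sum_nonneg)
  then show ?thesis
    by (simp add: l2_norm_def)
qed

lemma l2_norm_squared_sum: "(l2_norm x)\<^sup>2 = (\<Sum>i<dim_vec x. (x $ i)\<^sup>2)"
  unfolding l2_norm_squared by (simp add: scalar_prod_def power2_eq_square atLeast0LessThan)

lemma scalar_prod_le_l2_norm:
  assumes "x \<in> carrier_vec n" and "y \<in> carrier_vec n"
  shows "\<bar>x \<bullet> y\<bar> \<le> l2_norm x * l2_norm y"
proof -
  have "\<bar>x \<bullet> y\<bar> \<le> (\<Sum>i\<in>{0..<n}. \<bar>x $ i\<bar> * \<bar>y $ i\<bar>)"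
    using assms by (auto simp: scalar_prod_def abs_mult[symmetric] intro!: sum_abs)
  also have "\<dots> \<le> l2_norm x * l2_norm y"
    using assms L2_set_mult_ineq[of "\<lambda>i. x $ i" "\<lambda>i. y $ i" "{0..<n}"]
    by (simp add: l2_norm_eq_L2_set)
  finally show ?thesis .
qed

lemma l2_norm_smult: "l2_norm (a \<cdot>\<^sub>v x) = \<bar>a\<bar> * l2_norm x"
proof -
  have "(a \<cdot>\<^sub>v x) \<bullet> (a \<cdot>\<^sub>v x) = a\<^sup>2 * (x \<bullet> x)"
    by (simp add: power2_eq_square)
  then show ?thesis
    by (simp add: l2_norm_def real_sqrt_mult)
qed

lemma l2_norm_zero [simp]: "l2_norm (0\<^sub>v n) = 0"
  by (simp add: l2_norm_def)

text \<open>The Frobenius norm, grouped by columns. It makes the supremum in the spectral norm finite, and it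
  is the crude upper bound used wherever a factor depending on the number of columns is harmless.\<close>

definition frob_norm :: "real mat \<Rightarrow> real" where
  "frob_norm M = sqrt (\<Sum>j<dim_col M. (l2_norm (col M j))\<^sup>2)"

lemma frob_norm_nonneg [simp]: "0 \<le> frob_norm M"
  by (simp add: frob_norm_def sum_nonneg)

lemma frob_norm_rows: "(frob_norm M)\<^sup>2 = (\<Sum>i<dim_row M. (l2_norm (row M i))\<^sup>2)"
proof -
  have "(frob_norm M)\<^sup>2 = (\<Sum>j<dim_col M. \<Sum>i<dim_row M. (M $$ (i, j))\<^sup>2)"
    by (simp add: frob_norm_def sum_nonneg l2_norm_squared_sum)
  also have "\<dots> = (\<Sum>i<dim_row M. (l2_norm (row M i))\<^sup>2)"
    by (subst sum.swap) (simp add: l2_norm_squared_sum)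
  finally show ?thesis .
qed

lemma l2_norm_mult_le_frob:
  assumes "x \<in> carrier_vec (dim_col M)"
  shows "l2_norm (M *\<^sub>v x) \<le> frob_norm M * l2_norm x"
proof (rule power2_le_imp_le)
  have "(l2_norm (M *\<^sub>v x))\<^sup>2 = (\<Sum>i<dim_row M. (row M i \<bullet> x)\<^sup>2)"
    by (simp add: l2_norm_squared_sum)
  also have "\<dots> \<le> (\<Sum>i<dim_row M. (l2_norm (row M i) * l2_norm x)\<^sup>2)"
  proof (rule sum_mono)
    fix i
    have "\<bar>row M i \<bullet> x\<bar> \<le> l2_norm (row M i) * l2_norm x"
      using assms by (intro scalar_prod_le_l2_norm[of _ "dim_col M"]) auto
    from power_mono[OF this, of 2]
    show "(row M i \<bullet> x)\<^sup>2 \<le> (l2_norm (row M i) * l2_norm x)\<^sup>2"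
      by simp
  qed
  also have "\<dots> = (frob_norm M * l2_norm x)\<^sup>2"
    by (simp add: frob_norm_rows power_mult_distrib sum_distrib_right)
  finally show "(l2_norm (M *\<^sub>v x))\<^sup>2 \<le> (frob_norm M * l2_norm x)\<^sup>2" .
qed simp

lemma mat_norm2_bdd:
  "bdd_above {l2_norm (M *\<^sub>v x) | x. x \<in> carrier_vec (dim_col M) \<and> l2_norm x \<le> 1}"
proof (rule bdd_aboveI)
  fix r
  assume "r \<in> {l2_norm (M *\<^sub>v x) | x. x \<in> carrier_vec (dim_col M) \<and> l2_norm x \<le> 1}"
  then obtain x where x: "x \<in> carrier_vec (dim_col M)" "l2_norm x \<le> 1" "r = l2_norm (M *\<^sub>v x)"
    by auto
  have "frob_norm M * l2_norm x \<le> frob_norm M * 1"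
    using x by (intro mult_left_mono) auto
  then show "r \<le> frob_norm M"
    using l2_norm_mult_le_frob[OF x(1)] x by simp
qed

lemma mat_norm2_nonneg [simp]: "0 \<le> mat_norm2 M"
  unfolding mat_norm2_def
proof (rule cSup_upper[OF _ mat_norm2_bdd])
  have "l2_norm (M *\<^sub>v 0\<^sub>v (dim_col M)) = 0"
    by (subst mult_mat_vec_def) (simp add: l2_norm_eq_L2_set L2_set_def)
  then show "0 \<in> {l2_norm (M *\<^sub>v x) | x. x \<in> carrier_vec (dim_col M) \<and> l2_norm x \<le> 1}"
    by (intro CollectI exI[of _ "0\<^sub>v (dim_col M)"]) simp
qed

lemma l2_norm_mult_le:
  assumes M: "M \<in> carrier_mat r n" and x: "x \<in> carrier_vec n"
  shows "l2_norm (M *\<^sub>v x) \<le> mat_norm2 M * l2_norm x"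
proof (cases "l2_norm x = 0")
  case True
  then show ?thesis
    using l2_norm_mult_le_frob[of x M] M x by simp
next
  case False
  define z where "z = inverse (l2_norm x) \<cdot>\<^sub>v x"
  have z: "z \<in> carrier_vec n" "l2_norm z = 1" and xz: "x = l2_norm x \<cdot>\<^sub>v z"
    using x False by (auto simp: z_def l2_norm_smult smult_smult_assoc)
  have "l2_norm (M *\<^sub>v z) \<le> mat_norm2 M"
    unfolding mat_norm2_def using M z by (intro cSup_upper[OF _ mat_norm2_bdd]) auto
  moreover have "l2_norm (M *\<^sub>v x) = l2_norm x * l2_norm (M *\<^sub>v z)"
    using M z(1) by (subst xz) (simp add: mult_mat_vec[of M r n z] l2_norm_smult)
  ultimately show ?thesis
    by (simp add: mult.commute mult_left_mono)
qed

lemma mat_norm2_le: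
  assumes M: "M \<in> carrier_mat r n" and c: "0 \<le> c"
    and le: "\<And>x. x \<in> carrier_vec n \<Longrightarrow> l2_norm (M *\<^sub>v x) \<le> c * l2_norm x"
  shows "mat_norm2 M \<le> c"
  unfolding mat_norm2_def
proof (rule cSup_least)
  show "{l2_norm (M *\<^sub>v x) | x. x \<in> carrier_vec (dim_col M) \<and> l2_norm x \<le> 1} \<noteq> {}"
    by (auto intro!: exI[of _ "0\<^sub>v (dim_col M)"])
  fix s
  assume "s \<in> {l2_norm (M *\<^sub>v x) | x. x \<in> carrier_vec (dim_col M) \<and> l2_norm x \<le> 1}"
  then obtain x where x: "x \<in> carrier_vec n" "l2_norm x \<le> 1" "s = l2_norm (M *\<^sub>v x)"
    using M by auto
  then show "s \<le> c"
    using le[OF x(1)] mult_left_le[OF x(2) c] by simp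
qed

lemma frob_norm_le_entries:
  assumes "M \<in> carrier_mat k k" and "0 \<le> c"
    and "\<And>i j. i < k \<Longrightarrow> j < k \<Longrightarrow> \<bar>M $$ (i, j)\<bar> \<le> c"
  shows "frob_norm M \<le> real k * c"
proof -
  have "(\<Sum>j<k. \<Sum>i<k. (M $$ (i, j))\<^sup>2) \<le> (\<Sum>j<k. \<Sum>i<k. c\<^sup>2)"
    using assms by (intro sum_mono) (simp add: abs_le_square_iff[symmetric])
  moreover have "(frob_norm M)\<^sup>2 = (\<Sum>j<k. \<Sum>i<k. (M $$ (i, j))\<^sup>2)"
    using assms(1) by (simp add: frob_norm_def sum_nonneg l2_norm_squared_sum)
  ultimately have "(frob_norm M)\<^sup>2 \<le> (real k * c)\<^sup>2"
    by (simp add: power_mult_distrib) (simp add: power2_eq_square)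
  then show ?thesis
    using assms by (auto dest: power2_le_imp_le)
qed

lemma mat_norm2_le_frob: "mat_norm2 M \<le> frob_norm M"
  by (rule mat_norm2_le[of _ "dim_row M" "dim_col M"]) (auto intro: l2_norm_mult_le_frob)

lemma frob_norm_unit_cols:
  assumes "M \<in> carrier_mat r k" and "\<And>j. j < k \<Longrightarrow> l2_norm (col M j) = 1"
  shows "frob_norm M = sqrt (real k)"
  using assms by (simp add: frob_norm_def)

lemma l2_norm_col_le:
  assumes M: "M \<in> carrier_mat r k" and j: "j < k"
  shows "l2_norm (col M j) \<le> mat_norm2 M"
proof -
  have "col M j = M *\<^sub>v unit_vec k j"
    using M j by (intro eq_vecI) auto
  moreover have "l2_norm (unit_vec k j :: real vec) = 1"
    using j by (simp add: l2_norm_def)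
  ultimately show ?thesis
    using l2_norm_mult_le[OF M unit_vec_carrier, of j] by simp
qed

lemma scalar_prod_mult_le:
  assumes "M \<in> carrier_mat r n" and "x \<in> carrier_vec r" and "y \<in> carrier_vec n"
  shows "\<bar>x \<bullet> (M *\<^sub>v y)\<bar> \<le> mat_norm2 M * l2_norm x * l2_norm y"
proof -
  have "\<bar>x \<bullet> (M *\<^sub>v y)\<bar> \<le> l2_norm x * l2_norm (M *\<^sub>v y)"
    using assms by (intro scalar_prod_le_l2_norm[of _ r]) auto
  also have "\<dots> \<le> l2_norm x * (mat_norm2 M * l2_norm y)"
    using assms by (intro mult_left_mono l2_norm_mult_le) auto
  finally show ?thesis
    by (simp add: mult_ac)
qed

lemma scalar_prod_gram:
  fixes W :: "real mat"
  assumes "W \<in> carrier_mat d k" and "x \<in> carrier_vec k" and "y \<in> carrier_vec k"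
  shows "x \<bullet> ((W\<^sup>T * W) *\<^sub>v y) = (W *\<^sub>v x) \<bullet> (W *\<^sub>v y)"
proof -
  have "x \<bullet> ((W\<^sup>T * W) *\<^sub>v y) = x \<bullet> (W\<^sup>T *\<^sub>v (W *\<^sub>v y))"
    using assms by (subst assoc_mult_mat_vec[of _ k d _ k]) auto
  also have "\<dots> = (W\<^sup>T *\<^sub>v (W *\<^sub>v y)) \<bullet> x"
    using assms by (intro comm_scalar_prod[of _ k]) auto
  also have "\<dots> = (W *\<^sub>v y) \<bullet> (W *\<^sub>v x)"
    using assms by (intro transpose_vec_mult_scalar[of _ d k]) auto
  also have "\<dots> = (W *\<^sub>v x) \<bullet> (W *\<^sub>v y)"
    using assms by (intro comm_scalar_prod[of _ d]) auto
  finally show ?thesis .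
qed

section \<open>The orthogonality level as a bound on a bilinear form\<close>

lemma orth_defect_carrier:
  fixes W :: "real mat"
  shows "W \<in> carrier_mat d k \<Longrightarrow> 1\<^sub>m k - W\<^sup>T * W \<in> carrier_mat k k"
  by (intro minus_carrier_mat mult_carrier_mat[of _ k d]) auto

lemma scalar_prod_orth_defect:
  fixes W :: "real mat"
  assumes "W \<in> carrier_mat d k" and "x \<in> carrier_vec k" and "y \<in> carrier_vec k"
  shows "x \<bullet> ((1\<^sub>m k - W\<^sup>T * W) *\<^sub>v y) = x \<bullet> y - (W *\<^sub>v x) \<bullet> (W *\<^sub>v y)"
proof -
  have "(1\<^sub>m k - W\<^sup>T * W) *\<^sub>v y = y - (W\<^sup>T * W) *\<^sub>v y"
    using assms by (subst minus_mult_distrib_mat_vec[of _ k k]) auto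
  moreover have "x \<bullet> (y - (W\<^sup>T * W) *\<^sub>v y) = x \<bullet> y - x \<bullet> ((W\<^sup>T * W) *\<^sub>v y)"
    using assms by (intro scalar_prod_minus_distrib[of _ k]) auto
  ultimately show ?thesis
    using scalar_prod_gram[OF assms] by simp
qed

lemma orth_level_bound:
  assumes "W \<in> carrier_mat d k" and "x \<in> carrier_vec k" and "y \<in> carrier_vec k"
  shows "\<bar>x \<bullet> y - (W *\<^sub>v x) \<bullet> (W *\<^sub>v y)\<bar> \<le> orth_level W * l2_norm x * l2_norm y"
  using scalar_prod_mult_le[OF orth_defect_carrier[OF assms(1)] assms(2,3)]
    scalar_prod_orth_defect[OF assms] assms
  by (simp add: orth_level_def)

text \<open>Together with the preceding bound this says that the orthogonality level is the least constant
  \<open>c\<close> for which the form \<open>x \<bullet> y - W x \<bullet> W y\<close> is bounded by \<open>c\<close> times the two norms. The norm of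
  \<open>z = (I - W\<^sup>T W) x\<close> is reached by testing the form with \<open>z\<close> itself, so the spectral theorem for symmetric
  matrices is avoided. Stated with the form, all later identities are identities between real
  numbers.\<close>

lemma orth_level_le:
  assumes W: "W \<in> carrier_mat d k" and c: "0 \<le> c"
    and le: "\<And>x y. x \<in> carrier_vec k \<Longrightarrow> y \<in> carrier_vec k \<Longrightarrow>
      \<bar>x \<bullet> y - (W *\<^sub>v x) \<bullet> (W *\<^sub>v y)\<bar> \<le> c * l2_norm x * l2_norm y"
  shows "orth_level W \<le> c"
proof -
  have "mat_norm2 (1\<^sub>m k - W\<^sup>T * W) \<le> c"
  proof (rule mat_norm2_le[of _ k k])
    fix x :: "real vec"
    assume x: "x \<in> carrier_vec k"
    define z where "z = (1\<^sub>m k - W\<^sup>T * W) *\<^sub>v x"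
    have z: "z \<in> carrier_vec k"
      using orth_defect_carrier[OF W] x by (simp add: z_def)
    have "(l2_norm z)\<^sup>2 = z \<bullet> x - (W *\<^sub>v z) \<bullet> (W *\<^sub>v x)"
      using scalar_prod_orth_defect[OF W z x] by (simp add: l2_norm_squared z_def)
    then have "l2_norm z * l2_norm z \<le> (c * l2_norm x) * l2_norm z"
      using le[OF z x] by (simp add: power2_eq_square mult_ac)
    then have "l2_norm z \<le> c * l2_norm x"
      using c l2_norm_nonneg[of z] by (cases "l2_norm z = 0") (auto simp: mult_le_cancel_right)
    then show "l2_norm ((1\<^sub>m k - W\<^sup>T * W) *\<^sub>v x) \<le> c * l2_norm x"
      by (simp add: z_def)
  qed (use orth_defect_carrier[OF W] c in auto)
  then show ?thesis
    using W by (simp add: orth_level_def)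
qed

lemma orth_level_nonneg [simp]: "0 \<le> orth_level W"
  by (simp add: orth_level_def)

section \<open>Transfer of orthogonality between the two blocks\<close>

text \<open>Here \<open>X\<close> and \<open>Y\<close> stand for the two row blocks of \<open>Z\<close>, so that \<open>Z\<^sup>T Z = X\<^sup>T X + Y\<^sup>T Y\<close>. If \<open>F\<close> and \<open>G\<close>
  vanish, the identity
  \<open>H\<^sup>T (I - W\<^sup>T W) H = (I - Z\<^sup>T Z) - B\<^sup>T (I - U\<^sup>T U) B + E\<close> with \<open>E = B\<^sup>T B + H\<^sup>T H - I\<close> holds, and \<open>F\<close>, \<open>G\<close> add
  cross terms of size \<open>\<kappa> \<delta>\<close> and \<open>\<delta>\<^sup>2\<close>. The factor \<open>1 + e\<close> in front of the orthogonality level of \<open>U\<close> is a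
  bound for \<open>\<parallel>B\<parallel>\<^sup>2\<close>: it follows from \<open>B\<^sup>T B = I + E - H\<^sup>T H\<close>, as \<open>H\<^sup>T H\<close> is positive semidefinite.\<close>

lemma orth_defect_transfer:
  fixes Z X Y U W B H F G E :: "real mat"
  assumes Z: "Z \<in> carrier_mat q k" and X: "X \<in> carrier_mat m k" and Y: "Y \<in> carrier_mat p k"
    and U: "U \<in> carrier_mat m l" and B: "B \<in> carrier_mat l k" and F: "F \<in> carrier_mat m k"
    and W: "W \<in> carrier_mat p k" and H: "H \<in> carrier_mat k k" and G: "G \<in> carrier_mat p k"
    and E: "E \<in> carrier_mat k k"
    and split: "\<And>x y. x \<in> carrier_vec k \<Longrightarrow> y \<in> carrier_vec k \<Longrightarrow>
      (Z *\<^sub>v x) \<bullet> (Z *\<^sub>v y) = (X *\<^sub>v x) \<bullet> (X *\<^sub>v y) + (Y *\<^sub>v x) \<bullet> (Y *\<^sub>v y)"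
    and gram: "\<And>x y. x \<in> carrier_vec k \<Longrightarrow> y \<in> carrier_vec k \<Longrightarrow>
      (B *\<^sub>v x) \<bullet> (B *\<^sub>v y) + (H *\<^sub>v x) \<bullet> (H *\<^sub>v y) = x \<bullet> y + x \<bullet> (E *\<^sub>v y)"
    and XUB: "X = U * B + F" and YWH: "Y = W * H + G"
    and \<eta>: "\<And>x y. x \<in> carrier_vec k \<Longrightarrow> y \<in> carrier_vec k \<Longrightarrow>
      \<bar>x \<bullet> y - (Z *\<^sub>v x) \<bullet> (Z *\<^sub>v y)\<bar> \<le> \<eta> * l2_norm x * l2_norm y"
    and \<kappa>: "\<And>x. x \<in> carrier_vec k \<Longrightarrow> l2_norm (Z *\<^sub>v x) \<le> \<kappa> * l2_norm x"
    and e: "mat_norm2 E \<le> e"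
    and \<delta>F: "mat_norm2 F \<le> \<delta>" and \<delta>G: "mat_norm2 G \<le> \<delta>" and \<kappa>0: "0 \<le> \<kappa>"
    and x: "x \<in> carrier_vec k" and y: "y \<in> carrier_vec k"
  shows "\<bar>(H *\<^sub>v x) \<bullet> (H *\<^sub>v y) - (W *\<^sub>v (H *\<^sub>v x)) \<bullet> (W *\<^sub>v (H *\<^sub>v y))\<bar>
    \<le> (\<eta> + (1 + e) * orth_level U + (e + 4 * \<kappa> * \<delta> + 2 * \<delta>\<^sup>2)) * l2_norm x * l2_norm y"
proof -
  have \<delta>0: "0 \<le> \<delta>"
    using \<delta>F mat_norm2_nonneg[of F] by linarith
  have e0: "0 \<le> e"
    using e mat_norm2_nonneg[of E] by linarith
  have Xv: "X *\<^sub>v w = U *\<^sub>v (B *\<^sub>v w) + F *\<^sub>v w" if "w \<in> carrier_vec k" for w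
    using that U B F unfolding XUB
    by (subst add_mult_distrib_mat_vec[of _ m k]) (auto simp: assoc_mult_mat_vec[of U m l B k w])
  have Yv: "Y *\<^sub>v w = W *\<^sub>v (H *\<^sub>v w) + G *\<^sub>v w" if "w \<in> carrier_vec k" for w
    using that W H G unfolding YWH
    by (subst add_mult_distrib_mat_vec[of _ p k]) (auto simp: assoc_mult_mat_vec[of W p k H k w])
  have Xn: "l2_norm (X *\<^sub>v w) \<le> \<kappa> * l2_norm w" and Yn: "l2_norm (Y *\<^sub>v w) \<le> \<kappa> * l2_norm w"
    if w: "w \<in> carrier_vec k" for w
  proof -
    have "(l2_norm (Z *\<^sub>v w))\<^sup>2 = (l2_norm (X *\<^sub>v w))\<^sup>2 + (l2_norm (Y *\<^sub>v w))\<^sup>2"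
      using split[OF w w] by (simp add: l2_norm_squared)
    then have "(l2_norm (X *\<^sub>v w))\<^sup>2 \<le> (l2_norm (Z *\<^sub>v w))\<^sup>2"
      and "(l2_norm (Y *\<^sub>v w))\<^sup>2 \<le> (l2_norm (Z *\<^sub>v w))\<^sup>2"
      by auto
    then show "l2_norm (X *\<^sub>v w) \<le> \<kappa> * l2_norm w" and "l2_norm (Y *\<^sub>v w) \<le> \<kappa> * l2_norm w"
      using \<kappa>[OF w] by (auto dest: power2_le_imp_le)
  qed
  have Bn: "l2_norm (B *\<^sub>v w) \<le> sqrt (1 + e) * l2_norm w" if w: "w \<in> carrier_vec k" for w
  proof (rule power2_le_imp_le)
    have "(l2_norm (B *\<^sub>v w))\<^sup>2 \<le> w \<bullet> w + w \<bullet> (E *\<^sub>v w)"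
      using gram[OF w w] zero_le_power2[of "l2_norm (H *\<^sub>v w)"]
      unfolding l2_norm_squared by linarith
    also have "\<dots> \<le> (l2_norm w)\<^sup>2 + mat_norm2 E * l2_norm w * l2_norm w"
      using scalar_prod_mult_le[OF E w w] by (simp add: l2_norm_squared)
    also have "\<dots> \<le> (l2_norm w)\<^sup>2 + e * l2_norm w * l2_norm w"
      using e by (intro add_left_mono mult_right_mono) auto
    also have "\<dots> = (sqrt (1 + e) * l2_norm w)\<^sup>2"
      using e0 by (simp add: power_mult_distrib algebra_simps power2_eq_square)
    finally show "(l2_norm (B *\<^sub>v w))\<^sup>2 \<le> (sqrt (1 + e) * l2_norm w)\<^sup>2" .
  qed (use e0 in auto)
  have bnd: "\<bar>v \<bullet> v'\<bar> \<le> s * s' * (l2_norm x * l2_norm y)"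
    if "v \<in> carrier_vec d" "v' \<in> carrier_vec d" "l2_norm v \<le> s * l2_norm x"
      "l2_norm v' \<le> s' * l2_norm y" for v v' s s' and d :: nat
  proof -
    have "\<bar>v \<bullet> v'\<bar> \<le> l2_norm v * l2_norm v'"
      using that by (intro scalar_prod_le_l2_norm)
    also have "\<dots> \<le> (s * l2_norm x) * (s' * l2_norm y)"
      using that(3,4) order_trans[OF l2_norm_nonneg that(3)] by (intro mult_mono) auto
    finally show ?thesis
      by (simp add: mult_ac)
  qed
  have Fn: "l2_norm (F *\<^sub>v w) \<le> \<delta> * l2_norm w" and Gn: "l2_norm (G *\<^sub>v w) \<le> \<delta> * l2_norm w"
    if "w \<in> carrier_vec k" for w
    using l2_norm_mult_le[OF F that] l2_norm_mult_le[OF G that]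
      mult_right_mono[OF \<delta>F, of "l2_norm w"] mult_right_mono[OF \<delta>G, of "l2_norm w"] by auto
  define N where "N = l2_norm x * l2_norm y"
  \<comment> \<open>The cross terms are written with \<open>X\<close> rather than \<open>U B\<close>, because \<open>\<parallel>X\<parallel> \<le> \<parallel>Z\<parallel>\<close> gives their size
    without any bound on \<open>U\<close>; likewise for \<open>Y\<close> and \<open>W H\<close>.\<close>
  have X_split: "(X *\<^sub>v x) \<bullet> (X *\<^sub>v y) = (U *\<^sub>v (B *\<^sub>v x)) \<bullet> (U *\<^sub>v (B *\<^sub>v y))
      + (X *\<^sub>v x) \<bullet> (F *\<^sub>v y) + (F *\<^sub>v x) \<bullet> (X *\<^sub>v y) - (F *\<^sub>v x) \<bullet> (F *\<^sub>v y)"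
    using x y U B F
    by (simp add: Xv[OF x] Xv[OF y] add_scalar_prod_distrib[of _ m] scalar_prod_add_distrib[of _ m])
  have Y_split: "(Y *\<^sub>v x) \<bullet> (Y *\<^sub>v y) = (W *\<^sub>v (H *\<^sub>v x)) \<bullet> (W *\<^sub>v (H *\<^sub>v y))
      + (Y *\<^sub>v x) \<bullet> (G *\<^sub>v y) + (G *\<^sub>v x) \<bullet> (Y *\<^sub>v y) - (G *\<^sub>v x) \<bullet> (G *\<^sub>v y)"
    using x y W H G
    by (simp add: Yv[OF x] Yv[OF y] add_scalar_prod_distrib[of _ p] scalar_prod_add_distrib[of _ p])
  have errX: "\<bar>(X *\<^sub>v x) \<bullet> (F *\<^sub>v y)\<bar> \<le> \<kappa> * \<delta> * N" "\<bar>(F *\<^sub>v x) \<bullet> (X *\<^sub>v y)\<bar> \<le> \<delta> * \<kappa> * N"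
    "\<bar>(F *\<^sub>v x) \<bullet> (F *\<^sub>v y)\<bar> \<le> \<delta> * \<delta> * N"
    unfolding N_def using x y X F by (intro bnd[of _ m] Xn Fn; simp)+
  have errY: "\<bar>(Y *\<^sub>v x) \<bullet> (G *\<^sub>v y)\<bar> \<le> \<kappa> * \<delta> * N" "\<bar>(G *\<^sub>v x) \<bullet> (Y *\<^sub>v y)\<bar> \<le> \<delta> * \<kappa> * N"
    "\<bar>(G *\<^sub>v x) \<bullet> (G *\<^sub>v y)\<bar> \<le> \<delta> * \<delta> * N"
    unfolding N_def using x y Y G by (intro bnd[of _ p] Yn Gn; simp)+
  have errE: "\<bar>x \<bullet> (E *\<^sub>v y)\<bar> \<le> e * N"
    using scalar_prod_mult_le[OF E x y] mult_right_mono[OF e, of N]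
    by (simp add: N_def mult.assoc)
  have errZ: "\<bar>x \<bullet> y - (Z *\<^sub>v x) \<bullet> (Z *\<^sub>v y)\<bar> \<le> \<eta> * N"
    using \<eta>[OF x y] by (simp add: N_def mult.assoc)
  have errU: "\<bar>(B *\<^sub>v x) \<bullet> (B *\<^sub>v y) - (U *\<^sub>v (B *\<^sub>v x)) \<bullet> (U *\<^sub>v (B *\<^sub>v y))\<bar>
      \<le> (1 + e) * orth_level U * N"
  proof -
    have "\<bar>(B *\<^sub>v x) \<bullet> (B *\<^sub>v y) - (U *\<^sub>v (B *\<^sub>v x)) \<bullet> (U *\<^sub>v (B *\<^sub>v y))\<bar>
        \<le> orth_level U * (l2_norm (B *\<^sub>v x) * l2_norm (B *\<^sub>v y))"
      using orth_level_bound[OF U, of "B *\<^sub>v x" "B *\<^sub>v y"] B x y by (simp add: mult.assoc)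
    also have "\<dots> \<le> orth_level U * ((sqrt (1 + e) * l2_norm x) * (sqrt (1 + e) * l2_norm y))"
      using Bn[OF x] Bn[OF y] e0 by (intro mult_left_mono mult_mono) auto
    also have "\<dots> = (1 + e) * orth_level U * N"
      using e0 by (simp add: N_def algebra_simps)
    finally show ?thesis .
  qed
  have "(H *\<^sub>v x) \<bullet> (H *\<^sub>v y) - (W *\<^sub>v (H *\<^sub>v x)) \<bullet> (W *\<^sub>v (H *\<^sub>v y))
      = (x \<bullet> y - (Z *\<^sub>v x) \<bullet> (Z *\<^sub>v y))
        - ((B *\<^sub>v x) \<bullet> (B *\<^sub>v y) - (U *\<^sub>v (B *\<^sub>v x)) \<bullet> (U *\<^sub>v (B *\<^sub>v y)))
        + x \<bullet> (E *\<^sub>v y)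
        + ((X *\<^sub>v x) \<bullet> (F *\<^sub>v y) + (F *\<^sub>v x) \<bullet> (X *\<^sub>v y) - (F *\<^sub>v x) \<bullet> (F *\<^sub>v y))
        + ((Y *\<^sub>v x) \<bullet> (G *\<^sub>v y) + (G *\<^sub>v x) \<bullet> (Y *\<^sub>v y) - (G *\<^sub>v x) \<bullet> (G *\<^sub>v y))"
    using split[OF x y] gram[OF x y] X_split Y_split by linarith
  then have "\<bar>(H *\<^sub>v x) \<bullet> (H *\<^sub>v y) - (W *\<^sub>v (H *\<^sub>v x)) \<bullet> (W *\<^sub>v (H *\<^sub>v y))\<bar>
      \<le> \<eta> * N + (1 + e) * orth_level U * N + e * N + 4 * (\<kappa> * \<delta> * N) + 2 * (\<delta> * \<delta> * N)"
    using errX errY errE errZ errU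
    unfolding mult.commute[of \<delta> \<kappa>] abs_le_iff by linarith
  then show ?thesis
    by (simp add: N_def algebra_simps power2_eq_square)
qed

text \<open>Every pair of vectors is the image under \<open>H\<close> of its image under the inverse \<open>J\<close>, and passing to
  these preimages costs one factor \<open>\<parallel>J\<parallel>\<close> for each of the two arguments.\<close>

lemma orth_level_le_inverse:
  fixes W H J :: "real mat"
  assumes W: "W \<in> carrier_mat p k" and H: "H \<in> carrier_mat k k" and J: "J \<in> carrier_mat k k"
    and HJ: "H * J = 1\<^sub>m k" and c: "0 \<le> c"
    and le: "\<And>x y. x \<in> carrier_vec k \<Longrightarrow> y \<in> carrier_vec k \<Longrightarrow>
      \<bar>(H *\<^sub>v x) \<bullet> (H *\<^sub>v y) - (W *\<^sub>v (H *\<^sub>v x)) \<bullet> (W *\<^sub>v (H *\<^sub>v y))\<bar>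
        \<le> c * l2_norm x * l2_norm y"
  shows "orth_level W \<le> (mat_norm2 J)\<^sup>2 * c"
proof (rule orth_level_le[OF W])
  fix x y :: "real vec"
  assume x: "x \<in> carrier_vec k" and y: "y \<in> carrier_vec k"
  have HJv: "H *\<^sub>v (J *\<^sub>v w) = w" if "w \<in> carrier_vec k" for w
    using assoc_mult_mat_vec[OF H J that] HJ that by simp
  have "\<bar>x \<bullet> y - (W *\<^sub>v x) \<bullet> (W *\<^sub>v y)\<bar> \<le> c * l2_norm (J *\<^sub>v x) * l2_norm (J *\<^sub>v y)"
    using le[of "J *\<^sub>v x" "J *\<^sub>v y"] J x y by (simp add: HJv)
  also have "\<dots> = c * (l2_norm (J *\<^sub>v x) * l2_norm (J *\<^sub>v y))"
    by simp
  also have "\<dots> \<le> c * ((mat_norm2 J * l2_norm x) * (mat_norm2 J * l2_norm y))"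
    using c J x y by (intro mult_left_mono mult_mono l2_norm_mult_le) auto
  finally show "\<bar>x \<bullet> y - (W *\<^sub>v x) \<bullet> (W *\<^sub>v y)\<bar> \<le> (mat_norm2 J)\<^sup>2 * c * l2_norm x * l2_norm y"
    by (simp add: power2_eq_square mult_ac)
qed (use c in auto)

lemma mat_inv_inverse:
  assumes "invertible_mat H" and H: "H \<in> carrier_mat k k"
  shows "mat_inv H \<in> carrier_mat k k" and "H * mat_inv H = 1\<^sub>m k" and "mat_inv H * H = 1\<^sub>m k"
proof -
  obtain J where J: "H * J = 1\<^sub>m k" "J * H = 1\<^sub>m (dim_row J)"
    using assms by (auto simp: invertible_mat_def inverts_mat_def)
  have "dim_row J = k"
    using arg_cong[OF J(2), of dim_col] H by simp
  moreover have "dim_col J = k"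
    using arg_cong[OF J(1), of dim_col] by simp
  ultimately have "H \<in> Units (ring_mat TYPE(real) k ())"
    using H J by (auto simp: Units_def ring_mat_def intro!: bexI[of _ J])
  then obtain J' where "mat_inverse H = Some J'"
    using mat_inverse(1)[OF H, of "()"] by (cases "mat_inverse H") auto
  then show "mat_inv H \<in> carrier_mat k k" "H * mat_inv H = 1\<^sub>m k" "mat_inv H * H = 1\<^sub>m k"
    using mat_inverse(2)[OF H] by (auto simp: mat_inv_def)
qed

section \<open>Norm of a nearly orthogonal two-term combination\<close>

text \<open>Only the product \<open>b * (t \<bullet> s)\<close> is assumed to be small, as in local orthogonality, whereas the mixed
  term of \<open>\<parallel>a s + b t\<parallel>\<^sup>2\<close> is \<open>2 a b (t \<bullet> s)\<close>, so a bound on \<open>a\<close> is needed first. It comes from the same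
  expansion: \<open>a\<^sup>2 + b\<^sup>2 \<le> 4 + 2 \<bar>a\<bar>\<close>, hence \<open>\<bar>a\<bar> \<le> 1 + sqrt 5\<close>, and then \<open>b\<^sup>2 \<le> 4 + 2 * 4 < 4\<^sup>2\<close>.\<close>

lemma two_term_norm_defect:
  fixes a b \<delta> \<tau> :: real and d :: nat and f :: "real vec"
  assumes s: "s \<in> carrier_vec d" and t: "t \<in> carrier_vec d" and f: "f \<in> carrier_vec d"
    and unit: "l2_norm s = 1" "l2_norm t = 1"
    and z: "z = a \<cdot>\<^sub>v s + b \<cdot>\<^sub>v t + f" and zn: "l2_norm z \<le> 1"
    and fn: "l2_norm f \<le> \<delta>" "\<delta> \<le> 1"
    and orth: "\<bar>b * (t \<bullet> s)\<bar> \<le> \<tau>" "\<tau> \<le> 1"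
  shows "\<bar>a\<bar> \<le> 4" and "\<bar>b\<bar> \<le> 4" and "\<bar>a\<^sup>2 + b\<^sup>2 - (l2_norm z)\<^sup>2\<bar> \<le> 3 * \<delta> + 8 * \<tau>"
proof -
  define w where "w = a \<cdot>\<^sub>v s + b \<cdot>\<^sub>v t"
  have wc: "w \<in> carrier_vec d" and zc: "z \<in> carrier_vec d"
    using s t f by (auto simp: w_def z)
  have "w \<bullet> w = a\<^sup>2 * (s \<bullet> s) + b\<^sup>2 * (t \<bullet> t) + 2 * (a * (b * (t \<bullet> s)))"
    using s t comm_scalar_prod[OF s t]
    by (simp add: w_def add_scalar_prod_distrib[of _ d] scalar_prod_add_distrib[of _ d]
        power2_eq_square algebra_simps)
  then have ww: "w \<bullet> w = a\<^sup>2 + b\<^sup>2 + 2 * (a * (b * (t \<bullet> s)))"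
    using unit l2_norm_squared[of s] l2_norm_squared[of t] by simp
  have zz: "w \<bullet> w = z \<bullet> z - 2 * (z \<bullet> f) + f \<bullet> f"
    using wc f comm_scalar_prod[OF wc f]
    by (simp add: z w_def[symmetric] add_scalar_prod_distrib[of _ d] scalar_prod_add_distrib[of _ d])
  have "\<bar>z \<bullet> f\<bar> \<le> l2_norm z * l2_norm f"
    by (rule scalar_prod_le_l2_norm[OF zc f])
  also have "\<dots> \<le> 1 * \<delta>"
    using zn fn by (intro mult_mono) auto
  finally have zf: "\<bar>z \<bullet> f\<bar> \<le> \<delta>"
    by simp
  have "l2_norm f * l2_norm f \<le> \<delta> * 1"
    using fn order_trans[OF l2_norm_nonneg fn(1)] by (intro mult_mono) auto
  then have ff: "0 \<le> f \<bullet> f" "f \<bullet> f \<le> \<delta>"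
    by (simp_all add: l2_norm_squared[symmetric] power2_eq_square)
  have z2: "z \<bullet> z \<le> 1"
    using power_mono[OF zn, of 2] by (simp add: l2_norm_squared)
  have ab: "\<bar>a * (b * (t \<bullet> s))\<bar> \<le> \<bar>a\<bar> * \<tau>"
    using orth(1) by (simp add: abs_mult mult_left_mono)
  also have "\<dots> \<le> \<bar>a\<bar> * 1"
    using orth(2) by (intro mult_left_mono) auto
  finally have sum_le: "a\<^sup>2 + b\<^sup>2 \<le> 4 + 2 * \<bar>a\<bar>"
    using ww zz zf ff z2 fn(2) by linarith
  then have "a\<^sup>2 - 2 * \<bar>a\<bar> \<le> 4"
    using zero_le_power2[of b] by linarith
  then have "(\<bar>a\<bar> - 1)\<^sup>2 \<le> 3\<^sup>2"
    by (simp add: power2_diff)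
  from power2_le_imp_le[OF this] show a4: "\<bar>a\<bar> \<le> 4"
    by simp
  then have "b\<^sup>2 \<le> 16"
    using sum_le zero_le_power2[of a] by linarith
  then have "\<bar>b\<bar>\<^sup>2 \<le> 4\<^sup>2"
    by simp
  from power2_le_imp_le[OF this] show "\<bar>b\<bar> \<le> 4"
    by simp
  have "\<bar>a\<bar> * \<tau> \<le> 4 * \<tau>"
    using a4 orth(1) by (intro mult_right_mono) auto
  then show "\<bar>a\<^sup>2 + b\<^sup>2 - (l2_norm z)\<^sup>2\<bar> \<le> 3 * \<delta> + 8 * \<tau>"
    using ww zz zf ff ab by (simp add: l2_norm_squared)
qed

section \<open>Sign matrix, bidiagonal matrices and row blocks\<close>

lemma alt_diag_carrier [simp]: "alt_diag k \<in> carrier_mat k k"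
  by (simp add: alt_diag_def)

lemma alt_diag_index: "x \<in> carrier_vec k \<Longrightarrow> i < k \<Longrightarrow> (alt_diag k *\<^sub>v x) $ i = (- 1) ^ i * x $ i"
  by (auto simp: alt_diag_def mat_diag_def scalar_prod_def if_distribR if_distrib[of "\<lambda>c. c * _"]
      cong: if_cong)

lemma alt_diag_isometry:
  assumes "x \<in> carrier_vec k" and "y \<in> carrier_vec k"
  shows "(alt_diag k *\<^sub>v x) \<bullet> (alt_diag k *\<^sub>v y) = x \<bullet> y"
proof -
  have sq: "((- 1) ^ i * a) * ((- 1) ^ i * b) = a * (b :: real)" for i a b
    by (cases "even i") auto
  have "(alt_diag k *\<^sub>v x) \<bullet> (alt_diag k *\<^sub>v y)
      = (\<Sum>i\<in>{0..<k}. (alt_diag k *\<^sub>v x) $ i * (alt_diag k *\<^sub>v y) $ i)"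
    by (simp only: scalar_prod_def dim_mult_mat_vec carrier_matD(1)[OF alt_diag_carrier])
  also have "\<dots> = (\<Sum>i\<in>{0..<k}. x $ i * y $ i)"
    using assms by (intro sum.cong) (simp_all add: alt_diag_index sq del: index_mult_mat_vec)
  also have "\<dots> = x \<bullet> y"
    using assms by (simp add: scalar_prod_def)
  finally show ?thesis .
qed

lemma alt_diag_l2_norm: "x \<in> carrier_vec k \<Longrightarrow> l2_norm (alt_diag k *\<^sub>v x) = l2_norm x"
  by (simp add: l2_norm_def alt_diag_isometry)

lemma col_mult_alt_diag:
  assumes "M \<in> carrier_mat r k" and "j < k"
  shows "col (M * alt_diag k) j = (- 1) ^ j \<cdot>\<^sub>v col M j"
  using assms by (intro eq_vecI) (auto simp: alt_diag_def mat_diag_mult_right[OF assms(1)])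

lemma mat_norm2_mult_alt_diag:
  assumes M: "M \<in> carrier_mat r k"
  shows "mat_norm2 (M * alt_diag k) \<le> mat_norm2 M"
proof (rule mat_norm2_le[of _ r k])
  fix x :: "real vec"
  assume x: "x \<in> carrier_vec k"
  then show "l2_norm ((M * alt_diag k) *\<^sub>v x) \<le> mat_norm2 M * l2_norm x"
    using l2_norm_mult_le[OF M, of "alt_diag k *\<^sub>v x"] M mult_mat_vec_carrier[OF alt_diag_carrier x]
    by (simp add: assoc_mult_mat_vec[OF M alt_diag_carrier x] alt_diag_l2_norm)
qed (use M in auto)

lemma first_cols_carrier [simp]: "first_cols d j w \<in> carrier_mat d j"
  by (auto simp: first_cols_def mat_of_cols_def)

lemma first_cols_index: "r < d \<Longrightarrow> i < j \<Longrightarrow> first_cols d j w $$ (r, i) = w (Suc i) $ r"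
  by (simp add: first_cols_def mat_of_cols_def del: upt_Suc)

lemma col_first_cols: "i < j \<Longrightarrow> w (Suc i) \<in> carrier_vec d \<Longrightarrow> col (first_cols d j w) i = w (Suc i)"
  by (intro eq_vecI) (auto simp: first_cols_def mat_of_cols_def simp del: upt_Suc)

lemma lower_bidiag_carrier [simp]: "lower_bidiag k \<alpha> \<beta> \<in> carrier_mat (k + 1) k"
  by (simp add: lower_bidiag_def)

lemma upper_bidiag_carrier [simp]: "upper_bidiag k \<alpha> \<beta> \<in> carrier_mat k k"
  by (simp add: upper_bidiag_def)

text \<open>A column of a bidiagonal matrix has at most two nonzero entries. Taking the scalar product with an
  arbitrary vector covers both uses: rows of a matrix of computed vectors, which gives the columns of
  \<open>U * B\<close>, and other columns of the same matrix, which gives the tridiagonal Gram matrix.\<close>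

lemma scalar_prod_col_lower_bidiag:
  assumes w: "w \<in> carrier_vec (k + 1)" and i: "i < k"
  shows "w \<bullet> col (lower_bidiag k \<alpha> \<beta>) i = w $ i * \<alpha> (i + 1) + w $ (i + 1) * \<beta> (i + 2)"
proof -
  let ?c = "col (lower_bidiag k \<alpha> \<beta>) i"
  have "w \<bullet> ?c = (\<Sum>l<k + 1. w $ l * ?c $ l)"
    by (simp only: scalar_prod_def dim_col carrier_matD[OF lower_bidiag_carrier] atLeast0LessThan)
  also have "\<dots> = (\<Sum>l<k + 1. (if l = i then w $ l * \<alpha> (i + 1) else 0)
          + (if l = i + 1 then w $ l * \<beta> (i + 2) else 0))"
    using i by (intro sum.cong) (auto simp: lower_bidiag_def)
  also have "\<dots> = w $ i * \<alpha> (i + 1) + w $ (i + 1) * \<beta> (i + 2)"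
    using i by (subst sum.distrib) (simp only: sum.delta finite_lessThan, simp)
  finally show ?thesis .
qed

text \<open>At \<open>i = 0\<close> there is no superdiagonal entry, and truncated subtraction would take \<open>i - 1\<close> to the diagonal
  position; hence the case distinction.\<close>

lemma scalar_prod_col_upper_bidiag:
  assumes w: "w \<in> carrier_vec k" and i: "i < k"
  shows "w \<bullet> col (upper_bidiag k \<alpha> \<beta>) i
    = w $ i * \<alpha> (i + 1) + (if i = 0 then 0 else w $ (i - 1) * \<beta> i)"
proof -
  let ?c = "col (upper_bidiag k \<alpha> \<beta>) i"
  have "w \<bullet> ?c = (\<Sum>l<k. w $ l * ?c $ l)"
    by (simp only: scalar_prod_def dim_col carrier_matD[OF upper_bidiag_carrier] atLeast0LessThan)
  also have "\<dots> = (\<Sum>l<k. (if l = i then w $ l * \<alpha> (i + 1) else 0)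
          + (if l = i - 1 then (if i = 0 then 0 else w $ l * \<beta> i) else 0))"
    using i by (intro sum.cong) (auto simp: upper_bidiag_def)
  also have "\<dots> = w $ i * \<alpha> (i + 1) + (if i = 0 then 0 else w $ (i - 1) * \<beta> i)"
    using i by (subst sum.distrib) (simp only: sum.delta finite_lessThan, simp)
  finally show ?thesis .
qed

lemma lower_bidiag_gram:
  assumes i: "i < k" and j: "j < k"
  shows "col (lower_bidiag k \<alpha> \<beta>) i \<bullet> col (lower_bidiag k \<alpha> \<beta>) j
    = (if i = j then (\<alpha> (i + 1))\<^sup>2 + (\<beta> (i + 2))\<^sup>2 else if j = i + 1 then \<alpha> (i + 2) * \<beta> (i + 2)
       else if i = j + 1 then \<alpha> (j + 2) * \<beta> (j + 2) else 0)"
proof -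
  have entry: "col (lower_bidiag k \<alpha> \<beta>) i $ l
      = (if l = i then \<alpha> (i + 1) else if l = i + 1 then \<beta> (i + 2) else 0)" if "l < k + 1" for l
    using that i by (simp add: lower_bidiag_def)
  have "col (lower_bidiag k \<alpha> \<beta>) i \<in> carrier_vec (k + 1)"
    by (rule col_carrier_vec[OF i lower_bidiag_carrier])
  from scalar_prod_col_lower_bidiag[OF this j, of \<alpha> \<beta>] show ?thesis
    using j by (simp only: entry) (simp add: power2_eq_square)
qed

lemma upper_bidiag_gram:
  assumes i: "i < k" and j: "j < k"
  shows "col (upper_bidiag k \<alpha> \<beta>) i \<bullet> col (upper_bidiag k \<alpha> \<beta>) j
    = (if i = j then (\<alpha> (i + 1))\<^sup>2 + (if i = 0 then 0 else (\<beta> i)\<^sup>2)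
       else if j = i + 1 then \<alpha> (i + 1) * \<beta> (i + 1)
       else if i = j + 1 then \<alpha> (j + 1) * \<beta> (j + 1) else 0)"
proof -
  have entry: "col (upper_bidiag k \<alpha> \<beta>) i $ l
      = (if l = i then \<alpha> (l + 1) else if i = l + 1 then \<beta> (l + 1) else 0)" if "l < k" for l
    using that i by (simp add: upper_bidiag_def)
  have "col (upper_bidiag k \<alpha> \<beta>) i \<in> carrier_vec k"
    by (rule col_carrier_vec[OF i upper_bidiag_carrier])
  from scalar_prod_col_upper_bidiag[OF this j, of \<alpha> \<beta>] show ?thesis
    using j entry[of j] entry[of "j - 1"] by (cases j) (auto simp: power2_eq_square)
qed

lemma col_first_cols_mult_lower_bidiag:
  assumes i: "i < k" and w: "w (i + 1) \<in> carrier_vec d" "w (i + 2) \<in> carrier_vec d"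
  shows "col (first_cols d (k + 1) w * lower_bidiag k \<alpha> \<beta>) i
    = \<alpha> (i + 1) \<cdot>\<^sub>v w (i + 1) + \<beta> (i + 2) \<cdot>\<^sub>v w (i + 2)"
proof (rule eq_vecI)
  fix r
  assume "r < dim_vec (\<alpha> (i + 1) \<cdot>\<^sub>v w (i + 1) + \<beta> (i + 2) \<cdot>\<^sub>v w (i + 2))"
  then have r: "r < d"
    using w by simp
  have "row (first_cols d (k + 1) w) r \<in> carrier_vec (k + 1)"
    using row_carrier_vec[OF r first_cols_carrier] .
  then show "col (first_cols d (k + 1) w * lower_bidiag k \<alpha> \<beta>) i $ r
      = (\<alpha> (i + 1) \<cdot>\<^sub>v w (i + 1) + \<beta> (i + 2) \<cdot>\<^sub>v w (i + 2)) $ r"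
    using i r w carrier_matD[OF first_cols_carrier[of d "k + 1" w]]
      carrier_matD[OF lower_bidiag_carrier[of k \<alpha> \<beta>]]
    by (simp add: scalar_prod_col_lower_bidiag first_cols_index)
qed (use w carrier_matD[OF first_cols_carrier[of d "k + 1" w]] in auto)

lemma col_first_cols_mult_upper_bidiag:
  assumes i: "i < k" and w: "w (i + 1) \<in> carrier_vec d" "0 < i \<Longrightarrow> w i \<in> carrier_vec d"
  shows "col (first_cols d k w * upper_bidiag k \<alpha> \<beta>) i
    = (if i = 0 then \<alpha> (i + 1) \<cdot>\<^sub>v w (i + 1) else \<beta> i \<cdot>\<^sub>v w i + \<alpha> (i + 1) \<cdot>\<^sub>v w (i + 1))"
proof (rule eq_vecI)
  fix r
  assume "r < dim_vec (if i = 0 then \<alpha> (i + 1) \<cdot>\<^sub>v w (i + 1) else \<beta> i \<cdot>\<^sub>v w i + \<alpha> (i + 1) \<cdot>\<^sub>v w (i + 1))"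
  then have r: "r < d"
    using w by (simp split: if_splits)
  have "row (first_cols d k w) r \<in> carrier_vec k"
    using row_carrier_vec[OF r first_cols_carrier] .
  then show "col (first_cols d k w * upper_bidiag k \<alpha> \<beta>) i $ r
      = (if i = 0 then \<alpha> (i + 1) \<cdot>\<^sub>v w (i + 1) else \<beta> i \<cdot>\<^sub>v w i + \<alpha> (i + 1) \<cdot>\<^sub>v w (i + 1)) $ r"
    using i r w carrier_matD[OF first_cols_carrier[of d k w]]
      carrier_matD[OF upper_bidiag_carrier[of k \<alpha> \<beta>]]
    by (auto simp: scalar_prod_col_upper_bidiag first_cols_index)
qed (use w carrier_matD[OF first_cols_carrier[of d k w]] in auto)

text \<open>The first superdiagonal entry computed by the process has \<open>\<alpha> 1\<close> as a denominator, and
  positivity is known from the second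
  diagonal entry on only. If \<open>\<alpha> 1\<close> were zero, the first column would vanish.\<close>

lemma upper_bidiag_first_nonzero:
  assumes inv: "invertible_mat (upper_bidiag k \<alpha> \<beta>)" and k: "0 < k"
  shows "\<alpha> 1 \<noteq> 0"
proof
  assume 0: "\<alpha> 1 = 0"
  define J where "J = mat_inv (upper_bidiag k \<alpha> \<beta>)"
  note J = mat_inv_inverse[OF inv upper_bidiag_carrier, folded J_def]
  have "row J 0 \<in> carrier_vec k"
    using J(1) k by auto
  from scalar_prod_col_upper_bidiag[OF this k, of \<alpha> \<beta>]
  have "(J * upper_bidiag k \<alpha> \<beta>) $$ (0, 0) = 0"
    using J(1) k carrier_matD[OF upper_bidiag_carrier[of k \<alpha> \<beta>]] 0 by simp
  then show False
    using J(3) k by simp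
qed

lemma top_block_mult_vec:
  fixes w :: "real vec"
  assumes w: "w \<in> carrier_vec (m + p)"
  shows "(1\<^sub>m m @\<^sub>r 0\<^sub>m p m)\<^sup>T *\<^sub>v w = vec_first w m"
proof (rule eq_vecI)
  fix i
  assume "i < dim_vec (vec_first w m)"
  then have i: "i < m"
    by simp
  have "col (1\<^sub>m m @\<^sub>r 0\<^sub>m p m) i = (unit_vec (m + p) i :: real vec)"
    using i by (intro eq_vecI) (auto simp: append_rows_def unit_vec_def)
  then show "((1\<^sub>m m @\<^sub>r 0\<^sub>m p m)\<^sup>T *\<^sub>v w) $ i = vec_first w m $ i"
    using i w by (simp add: append_rows_def vec_first_def)
qed (simp add: append_rows_def)

lemma bottom_block_mult_vec:
  fixes w :: "real vec"
  assumes w: "w \<in> carrier_vec (m + p)"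
  shows "(0\<^sub>m m p @\<^sub>r 1\<^sub>m p)\<^sup>T *\<^sub>v w = vec_last w p"
proof (rule eq_vecI)
  fix i
  assume "i < dim_vec (vec_last w p)"
  then have i: "i < p"
    by simp
  have "col (0\<^sub>m m p @\<^sub>r 1\<^sub>m p) i = (unit_vec (m + p) (m + i) :: real vec)"
    using i by (intro eq_vecI) (auto simp: append_rows_def unit_vec_def)
  then show "((0\<^sub>m m p @\<^sub>r 1\<^sub>m p)\<^sup>T *\<^sub>v w) $ i = vec_last w p $ i"
    using i w by (simp add: append_rows_def vec_last_def)
qed (simp add: append_rows_def)

lemma scalar_prod_blocks:
  fixes w z :: "real vec"
  assumes w: "w \<in> carrier_vec (m + p)" and z: "z \<in> carrier_vec (m + p)"
  shows "w \<bullet> z = ((1\<^sub>m m @\<^sub>r 0\<^sub>m p m)\<^sup>T *\<^sub>v w) \<bullet> ((1\<^sub>m m @\<^sub>r 0\<^sub>m p m)\<^sup>T *\<^sub>v z)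
    + ((0\<^sub>m m p @\<^sub>r 1\<^sub>m p)\<^sup>T *\<^sub>v w) \<bullet> ((0\<^sub>m m p @\<^sub>r 1\<^sub>m p)\<^sup>T *\<^sub>v z)"
proof -
  have "w \<bullet> z = (vec_first w m @\<^sub>v vec_last w p) \<bullet> (vec_first z m @\<^sub>v vec_last z p)"
    using w z by simp
  also have "\<dots> = vec_first w m \<bullet> vec_first z m + vec_last w p \<bullet> vec_last z p"
    by (rule scalar_prod_append[of _ m _ p]) auto
  finally show ?thesis
    using w z by (simp add: top_block_mult_vec bottom_block_mult_vec)
qed

lemma block_carriers:
  "((1\<^sub>m m @\<^sub>r 0\<^sub>m p m)\<^sup>T :: real mat) \<in> carrier_mat m (m + p)"
  "((0\<^sub>m m p @\<^sub>r 1\<^sub>m p)\<^sup>T :: real mat) \<in> carrier_mat p (m + p)"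
  by auto

section \<open>The computed quantities\<close>

context computed_jbd
begin

abbreviation "top_part \<equiv> ((1\<^sub>m m @\<^sub>r 0\<^sub>m p m)\<^sup>T :: real mat)"
abbreviation "bottom_part \<equiv> ((0\<^sub>m m p @\<^sub>r 1\<^sub>m p)\<^sup>T :: real mat)"

lemma norm_parts_of_v:
  assumes "i < k"
  shows "(l2_norm (top_part *\<^sub>v v (i + 1)))\<^sup>2 + (l2_norm (bottom_part *\<^sub>v v (i + 1)))\<^sup>2 = 1"
proof -
  have "v (i + 1) \<in> carrier_vec (m + p)" and "l2_norm (v (i + 1)) = 1"
    using v_unit[of "i + 1"] assms by auto
  then show ?thesis
    using scalar_prod_blocks[of "v (i + 1)" m p "v (i + 1)"] l2_norm_squared[of "v (i + 1)"]
    by (simp add: l2_norm_squared)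
qed

lemma norm_part_of_v_le:
  assumes "i < k"
  shows "l2_norm (top_part *\<^sub>v v (i + 1)) \<le> 1" and "l2_norm (bottom_part *\<^sub>v v (i + 1)) \<le> 1"
proof -
  have "(l2_norm (top_part *\<^sub>v v (i + 1)))\<^sup>2 \<le> 1\<^sup>2"
    using norm_parts_of_v[OF assms] zero_le_power2[of "l2_norm (bottom_part *\<^sub>v v (i + 1))"]
    unfolding one_power2 by linarith
  then show "l2_norm (top_part *\<^sub>v v (i + 1)) \<le> 1"
    by (rule power2_le_imp_le) simp
  have "(l2_norm (bottom_part *\<^sub>v v (i + 1)))\<^sup>2 \<le> 1\<^sup>2"
    using norm_parts_of_v[OF assms] zero_le_power2[of "l2_norm (top_part *\<^sub>v v (i + 1))"]
    unfolding one_power2 by linarith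
  then show "l2_norm (bottom_part *\<^sub>v v (i + 1)) \<le> 1"
    by (rule power2_le_imp_le) simp
qed

lemma col_v: "i < k \<Longrightarrow> col (first_cols (m + p) k v) i = v (i + 1)"
  using v_unit[of "i + 1"] col_first_cols[of i k v "m + p"] by simp

text \<open>Column \<open>i\<close> of the relation for \<open>U\<close> writes the upper part of a computed unit vector \<open>v\<close> as a two-term combination of
  consecutive, locally orthogonal vectors \<open>u\<close>.\<close>

lemma lower_bidiag_coefficients:
  assumes i: "i < k" and small: "C * eps \<le> 1" "C * (c1 m n * eps) \<le> 1"
  shows "\<bar>\<alpha> (i + 1)\<bar> \<le> 4" and "\<bar>\<beta> (i + 2)\<bar> \<le> 4"
    and "\<bar>(\<alpha> (i + 1))\<^sup>2 + (\<beta> (i + 2))\<^sup>2 - (l2_norm (top_part *\<^sub>v v (i + 1)))\<^sup>2\<bar>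
      \<le> 3 * (C * eps) + 8 * (C * (c1 m n * eps))"
proof -
  obtain F where F: "F \<in> carrier_mat m k" "mat_norm2 F \<le> C * eps"
    and rel: "top_part * first_cols (m + p) k v
      = first_cols m (k + 1) u * lower_bidiag k \<alpha> \<beta> + F"
    using rel_F by blast
  have u: "u (i + 1) \<in> carrier_vec m" "l2_norm (u (i + 1)) = 1"
    "u (i + 2) \<in> carrier_vec m" "l2_norm (u (i + 2)) = 1"
    using i u_unit[of "i + 1"] u_unit[of "i + 2"] by auto
  have "top_part *\<^sub>v v (i + 1) = col (top_part * first_cols (m + p) k v) i"
    using i by (subst col_mult2[OF block_carriers(1) first_cols_carrier]) (auto simp: col_v)
  also have "\<dots> = col (first_cols m (k + 1) u * lower_bidiag k \<alpha> \<beta>) i + col F i"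
    unfolding rel
    by (rule col_add(1)[OF mult_carrier_mat[OF first_cols_carrier lower_bidiag_carrier] F(1) i])
  also have "\<dots> = \<alpha> (i + 1) \<cdot>\<^sub>v u (i + 1) + \<beta> (i + 2) \<cdot>\<^sub>v u (i + 2) + col F i"
    by (simp only: col_first_cols_mult_lower_bidiag[OF i u(1,3)])
  finally have z: "top_part *\<^sub>v v (i + 1)
    = \<alpha> (i + 1) \<cdot>\<^sub>v u (i + 1) + \<beta> (i + 2) \<cdot>\<^sub>v u (i + 2) + col F i" .
  have orth: "\<bar>\<beta> (i + 2) * (u (i + 2) \<bullet> u (i + 1))\<bar> \<le> C * (c1 m n * eps)"
    using i local_orth_u[of "i + 1"] beta_pos[of "i + 1"] by (simp add: abs_mult)
  have colF: "col F i \<in> carrier_vec m" "l2_norm (col F i) \<le> C * eps"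
    using col_carrier_vec[OF i F(1)] l2_norm_col_le[OF F(1) i] F(2) by auto
  note * = two_term_norm_defect[OF u(1,3) colF(1) u(2,4) z norm_part_of_v_le(1)[OF i] colF(2)
      small(1) orth small(2)]
  show "\<bar>\<alpha> (i + 1)\<bar> \<le> 4" and "\<bar>\<beta> (i + 2)\<bar> \<le> 4"
    and "\<bar>(\<alpha> (i + 1))\<^sup>2 + (\<beta> (i + 2))\<^sup>2 - (l2_norm (top_part *\<^sub>v v (i + 1)))\<^sup>2\<bar>
      \<le> 3 * (C * eps) + 8 * (C * (c1 m n * eps))"
    by (fact *)+
qed

text \<open>The same for the lower part and the hatted vectors. The sign contributed by the sign matrix does not
  change the norm. In the pair for a column \<open>i > 0\<close> the coefficient \<open>\<alpha>h (i + 1)\<close> belongs to the later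
  vector and is the one that local orthogonality controls.\<close>

lemma upper_bidiag_coefficients:
  assumes i: "i < k" and small: "C * eps \<le> 1" "0 \<le> C * (c2 p n * eps)" "C * (c2 p n * eps) \<le> 1"
  shows "\<bar>(\<alpha>h (i + 1))\<^sup>2 + (if i = 0 then 0 else (\<beta>h i)\<^sup>2)
      - (l2_norm (bottom_part *\<^sub>v v (i + 1)))\<^sup>2\<bar> \<le> 3 * (C * eps) + 8 * (C * (c2 p n * eps))"
proof -
  obtain F where F: "F \<in> carrier_mat p k" "mat_norm2 F \<le> C * eps"
    and rel: "bottom_part * first_cols (m + p) k v * alt_diag k
      = first_cols p k uh * upper_bidiag k \<alpha>h \<beta>h + F"
    using rel_Fbar by blast
  define z where "z = (- 1) ^ i \<cdot>\<^sub>v (bottom_part *\<^sub>v v (i + 1))"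
  have zn: "l2_norm z = l2_norm (bottom_part *\<^sub>v v (i + 1))"
    by (simp add: z_def l2_norm_smult power_abs)
  then have z1: "l2_norm z \<le> 1"
    using norm_part_of_v_le(2)[OF i] by simp
  have "z = col (bottom_part * first_cols (m + p) k v * alt_diag k) i"
    using i unfolding z_def
    by (subst col_mult_alt_diag[OF mult_carrier_mat[OF block_carriers(2) first_cols_carrier]])
      (auto simp: col_mult2[OF block_carriers(2) first_cols_carrier] col_v)
  also have "\<dots> = col (first_cols p k uh * upper_bidiag k \<alpha>h \<beta>h) i + col F i"
    unfolding rel
    by (rule col_add(1)[OF mult_carrier_mat[OF first_cols_carrier upper_bidiag_carrier] F(1) i])
  finally have z: "z = col (first_cols p k uh * upper_bidiag k \<alpha>h \<beta>h) i + col F i" .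
  have colF: "col F i \<in> carrier_vec p" "l2_norm (col F i) \<le> C * eps"
    using col_carrier_vec[OF i F(1)] l2_norm_col_le[OF F(1) i] F(2) by auto
  show ?thesis
  proof (cases "i = 0")
    case True
    have uh1: "uh (i + 1) \<in> carrier_vec p" "l2_norm (uh (i + 1)) = 1"
      using i uh_unit[of "i + 1"] by auto
    have "0 \<cdot>\<^sub>v uh (i + 1) = 0\<^sub>v p"
      using uh1(1) by (intro eq_vecI) auto
    \<comment> \<open>There is no predecessor: the same vector with coefficient \<open>0\<close> fills the second slot.\<close>
    then have "z = \<alpha>h (i + 1) \<cdot>\<^sub>v uh (i + 1) + 0 \<cdot>\<^sub>v uh (i + 1) + col F i"
      using z True uh1 col_first_cols_mult_upper_bidiag[where w = uh, OF i uh1(1), of \<alpha>h \<beta>h] by simp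
    from two_term_norm_defect(3)[OF uh1(1,1) colF(1) uh1(2,2) this z1 colF(2) small(1) _ small(3)]
    show ?thesis
      using True small(2) by (simp add: zn)
  next
    case False
    then have i0: "0 < i"
      by simp
    have uh1: "uh (i + 1) \<in> carrier_vec p" "l2_norm (uh (i + 1)) = 1"
      "uh i \<in> carrier_vec p" "l2_norm (uh i) = 1"
      using i i0 uh_unit[of "i + 1"] uh_unit[of i] by auto
    have zz: "z = \<beta>h i \<cdot>\<^sub>v uh i + \<alpha>h (i + 1) \<cdot>\<^sub>v uh (i + 1) + col F i"
      using z False col_first_cols_mult_upper_bidiag[where w = uh, OF i uh1(1,3), of \<alpha>h \<beta>h] by simp
    have "\<bar>\<alpha>h (i + 1) * (uh (i + 1) \<bullet> uh i)\<bar> \<le> C * (c2 p n * eps)"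
      using i i0 local_orth_uh[of i] alpha_hat_pos[of i] by (simp add: abs_mult)
    from two_term_norm_defect(3)[OF uh1(3,1) colF(1) uh1(4,2) zz z1 colF(2) small(1) this small(3)]
    show ?thesis
      using False by (simp add: zn add.commute)
  qed
qed

text \<open>The computed \<open>\<beta>h\<close> is the exact quotient up to a relative error, so the off-diagonal entries of the two
  Gram matrices agree up to that error times \<open>\<alpha> * \<beta>\<close>, and both factors are at most \<open>4\<close> in absolute value.\<close>

lemma off_diagonal_cancellation:
  assumes i: "i + 1 < k" and small: "C * eps \<le> 1" "C * (c1 m n * eps) \<le> 1"
  shows "\<bar>\<alpha>h (i + 1) * \<beta>h (i + 1) - \<alpha> (i + 2) * \<beta> (i + 2)\<bar> \<le> 16 * (C * eps)"
proof -
  obtain \<rho> where \<rho>: "\<bar>\<rho>\<bar> \<le> C * eps"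
    "\<beta>h (i + 1) = \<alpha> (i + 2) * \<beta> (i + 2) / \<alpha>h (i + 1) * (1 + \<rho>)"
    using beta_hat[of "i + 1"] i by auto
  have "\<alpha>h (i + 1) \<noteq> 0"
  proof (cases i)
    case 0
    then show ?thesis
      using upper_bidiag_first_nonzero[OF Bh_invertible] i by simp
  next
    case (Suc j)
    then show ?thesis
      using alpha_hat_pos[of i] i by simp
  qed
  then have "\<alpha>h (i + 1) * \<beta>h (i + 1) - \<alpha> (i + 2) * \<beta> (i + 2) = \<alpha> (i + 2) * \<beta> (i + 2) * \<rho>"
    unfolding \<rho>(2) by (simp add: field_simps)
  moreover have "\<bar>\<alpha> (i + 2) * \<beta> (i + 2)\<bar> \<le> 4 * 4"
    unfolding abs_mult using i lower_bidiag_coefficients(1)[of "i + 1"] lower_bidiag_coefficients(2)[of i] small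
    by (intro mult_mono) auto
  then have "\<bar>\<alpha> (i + 2) * \<beta> (i + 2)\<bar> * \<bar>\<rho>\<bar> \<le> 16 * (C * eps)"
    using \<rho>(1) by (intro mult_mono) auto
  ultimately show ?thesis
    by (simp add: abs_mult)
qed

definition "signed_lower = lower_bidiag k \<alpha> \<beta> * alt_diag k"

text \<open>The residual \<open>E = B\<^sup>T B + H\<^sup>T H - I\<close> of the relation that exact arithmetic imposes on the two bidiagonal
  matrices, the lower one taken with its signs.\<close>

definition "gram_error
  = signed_lower\<^sup>T * signed_lower + (upper_bidiag k \<alpha>h \<beta>h)\<^sup>T * upper_bidiag k \<alpha>h \<beta>h - 1\<^sub>m k"

lemma signed_lower_carrier: "signed_lower \<in> carrier_mat (k + 1) k"
  unfolding signed_lower_def by (rule mult_carrier_mat[OF lower_bidiag_carrier alt_diag_carrier])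

lemma gram_error_carrier: "gram_error \<in> carrier_mat k k"
  unfolding gram_error_def by (intro minus_carrier_mat one_carrier_mat)

lemma gram_error_index:
  assumes i: "i < k" and j: "j < k"
  shows "gram_error $$ (i, j) = (- 1) ^ (i + j) *
      (col (lower_bidiag k \<alpha> \<beta>) i \<bullet> col (lower_bidiag k \<alpha> \<beta>) j)
    + col (upper_bidiag k \<alpha>h \<beta>h) i \<bullet> col (upper_bidiag k \<alpha>h \<beta>h) j - (if i = j then 1 else 0)"
proof -
  have "col signed_lower i \<bullet> col signed_lower j = (- 1) ^ (i + j) *
      (col (lower_bidiag k \<alpha> \<beta>) i \<bullet> col (lower_bidiag k \<alpha> \<beta>) j)"
    using i j by (simp add: signed_lower_def col_mult_alt_diag[OF lower_bidiag_carrier] power_add)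
  then show ?thesis
    using i j carrier_matD[OF signed_lower_carrier] carrier_matD[OF upper_bidiag_carrier[of k \<alpha>h \<beta>h]]
    by (simp add: gram_error_def)
qed

lemma gram_error_form:
  assumes x: "x \<in> carrier_vec k" and y: "y \<in> carrier_vec k"
  shows "(signed_lower *\<^sub>v x) \<bullet> (signed_lower *\<^sub>v y)
      + (upper_bidiag k \<alpha>h \<beta>h *\<^sub>v x) \<bullet> (upper_bidiag k \<alpha>h \<beta>h *\<^sub>v y) = x \<bullet> y + x \<bullet> (gram_error *\<^sub>v y)"
proof -
  let ?B = "signed_lower\<^sup>T * signed_lower" and ?H = "(upper_bidiag k \<alpha>h \<beta>h)\<^sup>T * upper_bidiag k \<alpha>h \<beta>h"
  have B: "?B \<in> carrier_mat k k" and H: "?H \<in> carrier_mat k k"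
    using signed_lower_carrier upper_bidiag_carrier[of k \<alpha>h \<beta>h]
    by (metis mult_carrier_mat transpose_carrier_mat)+
  have By: "?B *\<^sub>v y \<in> carrier_vec k" and Hy: "?H *\<^sub>v y \<in> carrier_vec k"
    using mult_mat_vec_carrier[OF B y] mult_mat_vec_carrier[OF H y] by auto
  have "gram_error *\<^sub>v y = ?B *\<^sub>v y + ?H *\<^sub>v y - y"
    unfolding gram_error_def
    by (simp only: minus_mult_distrib_mat_vec[OF add_carrier_mat[OF H] one_carrier_mat y]
        add_mult_distrib_mat_vec[OF B H y] one_mult_mat_vec[OF y])
  then have "x \<bullet> (gram_error *\<^sub>v y) = x \<bullet> (?B *\<^sub>v y) + x \<bullet> (?H *\<^sub>v y) - x \<bullet> y"
    by (simp only: scalar_prod_minus_distrib[OF x add_carrier_vec[OF By Hy] y]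
        scalar_prod_add_distrib[OF x By Hy])
  then show ?thesis
    by (simp only: scalar_prod_gram[OF signed_lower_carrier x y]
        scalar_prod_gram[OF upper_bidiag_carrier x y])
qed

text \<open>The residual is tridiagonal. A diagonal entry is the squared norm of the upper part plus that of the
  lower part of a unit vector, minus \<open>1\<close>, up to the errors of the two-term expansions: with
  \<open>d = C * eps\<close>, \<open>d1 = c1 d\<close> and \<open>d2 = c2 d\<close> these add up to \<open>6 d + 8 (d1 + d2) \<le> 11 (d1 + d2)\<close>. Off the diagonal, the sign
  matrix makes the two products \<open>\<alpha> * \<beta>\<close> and \<open>\<alpha>h * \<beta>h\<close> enter with opposite signs, and their
  difference, at most \<open>16 d\<close>, is what the constant \<open>16\<close> comes from.\<close>

lemma gram_error_entry_le:
  assumes i: "i < k" and j: "j < k" and eps: "0 < C" "0 < eps"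
    and c: "1 \<le> c1 m n" "1 \<le> c2 p n" and small: "C * (c3 c1 c2 m n p * eps) \<le> 1"
  shows "\<bar>gram_error $$ (i, j)\<bar> \<le> 16 * (C * (c3 c1 c2 m n p * eps))"
proof -
  define d d1 d2 where "d = C * eps" and "d1 = C * (c1 m n * eps)" and "d2 = C * (c2 p n * eps)"
  have d: "0 < d"
    using eps by (simp add: d_def)
  have eqs: "C * eps = d" "C * (c1 m n * eps) = d1" "C * (c2 p n * eps) = d2"
    "C * (c3 c1 c2 m n p * eps) = d1 + d2"
    by (simp_all add: d_def d1_def d2_def c3_def algebra_simps)
  have le: "d \<le> d1" "d \<le> d2"
    using c eps by (simp_all add: d_def d1_def d2_def)
  note small = small[unfolded eqs]
  have s1: "d \<le> 1" "d1 \<le> 1" "0 \<le> d2" "d2 \<le> 1"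
    using small le d by linarith+
  note lower = lower_bidiag_coefficients(3)[unfolded eqs, OF _ s1(1,2)]
  note upper = upper_bidiag_coefficients[unfolded eqs, OF _ s1(1,3,4)]
  note off = off_diagonal_cancellation[unfolded eqs, OF _ s1(1,2)]
  consider "i = j" | "j = i + 1" | "i = j + 1" | "i \<noteq> j" "j \<noteq> i + 1" "i \<noteq> j + 1"
    by blast
  then show ?thesis
    unfolding eqs
  proof cases
    case 1
    have regroup: "a + b - 1 = (a - s) + (b - t)" if "s + t = 1" for a b s t :: real
      using that by simp
    have "gram_error $$ (i, j) = ((\<alpha> (i + 1))\<^sup>2 + (\<beta> (i + 2))\<^sup>2)
        + ((\<alpha>h (i + 1))\<^sup>2 + (if i = 0 then 0 else (\<beta>h i)\<^sup>2)) - 1"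
      using 1 i by (simp add: gram_error_index lower_bidiag_gram upper_bidiag_gram)
    also have "\<dots> = ((\<alpha> (i + 1))\<^sup>2 + (\<beta> (i + 2))\<^sup>2 - (l2_norm (top_part *\<^sub>v v (i + 1)))\<^sup>2)
        + ((\<alpha>h (i + 1))\<^sup>2 + (if i = 0 then 0 else (\<beta>h i)\<^sup>2)
          - (l2_norm (bottom_part *\<^sub>v v (i + 1)))\<^sup>2)"
      by (rule regroup[OF norm_parts_of_v[OF i]])
    finally have "\<bar>gram_error $$ (i, j)\<bar> \<le> (3 * d + 8 * (d1)) + (3 * d + 8 * (d2))"
      by (simp only: order_trans[OF abs_triangle_ineq add_mono[OF lower[OF i] upper[OF i]]])
    then show "\<bar>gram_error $$ (i, j)\<bar> \<le> 16 * (d1 + d2)"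
      using le d by (simp add: algebra_simps)
  next
    case 2
    have "gram_error $$ (i, j) = \<alpha>h (i + 1) * \<beta>h (i + 1) - \<alpha> (i + 2) * \<beta> (i + 2)"
      using 2 i j by (simp add: gram_error_index lower_bidiag_gram upper_bidiag_gram)
    then show "\<bar>gram_error $$ (i, j)\<bar> \<le> 16 * (d1 + d2)"
      using off[of i] 2 j le d by simp
  next
    case 3
    have "gram_error $$ (i, j) = \<alpha>h (j + 1) * \<beta>h (j + 1) - \<alpha> (j + 2) * \<beta> (j + 2)"
      using 3 i j by (simp add: gram_error_index lower_bidiag_gram upper_bidiag_gram)
    then show "\<bar>gram_error $$ (i, j)\<bar> \<le> 16 * (d1 + d2)"
      using off[of j] 3 i le d by simp
  next
    case 4
    then have "gram_error $$ (i, j) = 0"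
      using i j by (simp add: gram_error_index lower_bidiag_gram upper_bidiag_gram)
    then show "\<bar>gram_error $$ (i, j)\<bar> \<le> 16 * (d1 + d2)"
      using le d by simp
  qed
qed

text \<open>The threshold on \<open>eps\<close> makes the norm of the residual at most \<open>1\<close>, so that \<open>\<parallel>B\<parallel>\<^sup>2 \<le> 2\<close>: this is the
  factor in front of the orthogonality level of \<open>U\<close>. With \<open>\<delta> = C * eps\<close> and \<open>t = C * (c3 * eps)\<close>, the constant \<open>22 k\<close>
  collects \<open>16 k t\<close> from the residual and \<open>4 k \<delta> + 2 \<delta>\<^sup>2 \<le> 6 k t\<close> from the cross terms.\<close>

lemma orth_level_uh_le:
  assumes k: "1 \<le> k" and C: "0 < C" and eps: "0 < eps"
    and c: "1 \<le> c1 m n" "1 \<le> c2 p n"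
    and small: "16 * real k * (C * (c3 c1 c2 m n p * eps)) \<le> 1"
  shows "orth_level (first_cols p k uh)
    \<le> (mat_norm2 (mat_inv (upper_bidiag k \<alpha>h \<beta>h)))\<^sup>2 *
      (orth_level (first_cols (m + p) k v) + 2 * orth_level (first_cols m (k + 1) u)
        + 22 * real k * C * (c3 c1 c2 m n p * eps))"
proof -
  define t where "t = C * (c3 c1 c2 m n p * eps)"
  define \<delta> where "\<delta> = C * eps"
  define V where "V = first_cols (m + p) k v"
  define U where "U = first_cols m (k + 1) u"
  define W where "W = first_cols p k uh"
  define H where "H = upper_bidiag k \<alpha>h \<beta>h"
  define D where "D = alt_diag k"
  have t0: "0 < t" and \<delta>0: "0 < \<delta>"
    using C eps c by (auto simp: t_def \<delta>_def c3_def intro!: mult_pos_pos)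
  have "1 * \<delta> \<le> c3 c1 c2 m n p * \<delta>"
    using c \<delta>0 by (intro mult_right_mono) (auto simp: c3_def)
  then have \<delta>t: "\<delta> \<le> t"
    by (simp add: t_def \<delta>_def mult_ac)
  have "1 * t \<le> 16 * real k * t"
    using k t0 by (intro mult_right_mono) auto
  then have t1: "t \<le> 1"
    using small by (simp add: t_def)
  have E: "mat_norm2 gram_error \<le> 16 * real k * t"
  proof -
    have "frob_norm gram_error \<le> real k * (16 * t)"
      using gram_error_entry_le[OF _ _ C eps c] t0 t1
      by (intro frob_norm_le_entries[OF gram_error_carrier]) (auto simp: t_def)
    then show ?thesis
      using mat_norm2_le_frob[of gram_error] by simp
  qed
  obtain F where F: "F \<in> carrier_mat m k" "mat_norm2 F \<le> \<delta>"
    and relF: "top_part * V = U * lower_bidiag k \<alpha> \<beta> + F"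
    using rel_F unfolding \<delta>_def V_def U_def by blast
  obtain G where G: "G \<in> carrier_mat p k" "mat_norm2 G \<le> \<delta>"
    and relG: "bottom_part * V * D = W * H + G"
    using rel_Fbar unfolding \<delta>_def V_def W_def H_def D_def by blast
  have Vc: "V \<in> carrier_mat (m + p) k" and Uc: "U \<in> carrier_mat m (k + 1)"
    and Wc: "W \<in> carrier_mat p k" and Hc: "H \<in> carrier_mat k k" and Dc: "D \<in> carrier_mat k k"
    by (simp_all add: V_def U_def W_def H_def D_def)
  have Dv: "D *\<^sub>v x \<in> carrier_vec k" "l2_norm (D *\<^sub>v x) = l2_norm x" if "x \<in> carrier_vec k" for x
    using that mult_mat_vec_carrier[OF Dc that] by (auto simp: D_def alt_diag_l2_norm)
  have VD: "(V * D) *\<^sub>v x = V *\<^sub>v (D *\<^sub>v x)" if "x \<in> carrier_vec k" for x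
    by (rule assoc_mult_mat_vec[OF Vc Dc that])
  have VDc: "V * D \<in> carrier_mat (m + p) k"
    by (rule mult_carrier_mat[OF Vc Dc])
  have parts: "(top_part * (V * D)) *\<^sub>v x = top_part *\<^sub>v ((V * D) *\<^sub>v x)"
    "(bottom_part * (V * D)) *\<^sub>v x = bottom_part *\<^sub>v ((V * D) *\<^sub>v x)" if "x \<in> carrier_vec k" for x
    by (rule assoc_mult_mat_vec[OF block_carriers(1) VDc that],
        rule assoc_mult_mat_vec[OF block_carriers(2) VDc that])
  have V_frob: "frob_norm V \<le> real k"
  proof -
    have "frob_norm V = sqrt (real k)"
      using frob_norm_unit_cols[OF Vc] v_unit by (simp add: V_def col_v)
    also have "\<dots> \<le> sqrt (real k * real k)"
      using k by (intro real_sqrt_le_mono) (simp add: mult_le_cancel_left1)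
    finally show ?thesis
      by simp
  qed
  have X: "top_part * (V * D) = U * signed_lower + F * D"
  proof -
    have "top_part * (V * D) = (top_part * V) * D"
      by (rule assoc_mult_mat[OF block_carriers(1) Vc Dc, symmetric])
    also have "\<dots> = (U * lower_bidiag k \<alpha> \<beta>) * D + F * D"
      unfolding relF
      by (rule add_mult_distrib_mat[OF mult_carrier_mat[OF Uc lower_bidiag_carrier] F(1) Dc])
    also have "(U * lower_bidiag k \<alpha> \<beta>) * D = U * signed_lower"
      unfolding signed_lower_def D_def[symmetric]
      by (rule assoc_mult_mat[OF Uc lower_bidiag_carrier Dc])
    finally show ?thesis .
  qed
  have Y: "bottom_part * (V * D) = W * H + G"
    using relG by (simp only: assoc_mult_mat[OF block_carriers(2) Vc Dc])
  let ?c = "orth_level V + 2 * orth_level U + 22 * real k * C * (c3 c1 c2 m n p * eps)"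
  have main: "\<bar>(H *\<^sub>v x) \<bullet> (H *\<^sub>v y) - (W *\<^sub>v (H *\<^sub>v x)) \<bullet> (W *\<^sub>v (H *\<^sub>v y))\<bar>
      \<le> ?c * l2_norm x * l2_norm y" if x: "x \<in> carrier_vec k" and y: "y \<in> carrier_vec k" for x y
  proof -
    have "\<bar>(H *\<^sub>v x) \<bullet> (H *\<^sub>v y) - (W *\<^sub>v (H *\<^sub>v x)) \<bullet> (W *\<^sub>v (H *\<^sub>v y))\<bar>
      \<le> (orth_level V + (1 + 16 * real k * t) * orth_level U
          + (16 * real k * t + 4 * real k * \<delta> + 2 * \<delta>\<^sup>2)) * l2_norm x * l2_norm y"
    proof (rule orth_defect_transfer[where Z = "V * D" and X = "top_part * (V * D)"
          and Y = "bottom_part * (V * D)" and B = signed_lower and F = "F * D" and G = G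
          and E = gram_error])
      fix x y :: "real vec"
      assume x: "x \<in> carrier_vec k" and y: "y \<in> carrier_vec k"
      show "((V * D) *\<^sub>v x) \<bullet> ((V * D) *\<^sub>v y)
        = ((top_part * (V * D)) *\<^sub>v x) \<bullet> ((top_part * (V * D)) *\<^sub>v y)
          + ((bottom_part * (V * D)) *\<^sub>v x) \<bullet> ((bottom_part * (V * D)) *\<^sub>v y)"
        unfolding parts[OF x] parts[OF y]
        by (rule scalar_prod_blocks[OF mult_mat_vec_carrier[OF VDc x] mult_mat_vec_carrier[OF VDc y]])
      show "(signed_lower *\<^sub>v x) \<bullet> (signed_lower *\<^sub>v y) + (H *\<^sub>v x) \<bullet> (H *\<^sub>v y)
          = x \<bullet> y + x \<bullet> (gram_error *\<^sub>v y)"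
        unfolding H_def by (rule gram_error_form[OF x y])
      show "\<bar>x \<bullet> y - ((V * D) *\<^sub>v x) \<bullet> ((V * D) *\<^sub>v y)\<bar> \<le> orth_level V * l2_norm x * l2_norm y"
        using orth_level_bound[OF Vc Dv(1)[OF x] Dv(1)[OF y]]
          alt_diag_isometry[OF x y, folded D_def]
        by (simp only: VD[OF x] VD[OF y] Dv(2)[OF x] Dv(2)[OF y])
    next
      fix x :: "real vec"
      assume x: "x \<in> carrier_vec k"
      have "l2_norm (V *\<^sub>v (D *\<^sub>v x)) \<le> frob_norm V * l2_norm (D *\<^sub>v x)"
        using Dv(1)[OF x] Vc by (intro l2_norm_mult_le_frob) simp
      also have "\<dots> \<le> real k * l2_norm x"
        unfolding Dv(2)[OF x] using V_frob by (intro mult_right_mono) auto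
      finally show "l2_norm ((V * D) *\<^sub>v x) \<le> real k * l2_norm x"
        by (simp only: VD[OF x])
    next
      show "mat_norm2 (F * D) \<le> \<delta>"
        using mat_norm2_mult_alt_diag[OF F(1)] F(2) by (simp add: D_def)
    qed (use x y E Vc Uc Wc Hc VDc G X Y signed_lower_carrier gram_error_carrier
        mult_carrier_mat[OF F(1) Dc] mult_carrier_mat[OF block_carriers(1) VDc]
        mult_carrier_mat[OF block_carriers(2) VDc] in simp_all)
    also have "\<dots> \<le> ?c * l2_norm x * l2_norm y"
    proof -
      have "(1 + 16 * real k * t) * orth_level U \<le> 2 * orth_level U"
        using small by (intro mult_right_mono) (auto simp: t_def)
      moreover have "\<delta>\<^sup>2 \<le> real k * t"
      proof -
        have "\<delta> * \<delta> \<le> real k * t"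
          using \<delta>0 \<delta>t t1 k by (intro mult_mono) auto
        then show ?thesis
          by (simp add: power2_eq_square)
      qed
      moreover have "real k * \<delta> \<le> real k * t"
        using \<delta>t by (intro mult_left_mono) auto
      moreover have "22 * real k * C * (c3 c1 c2 m n p * eps) = 22 * (real k * t)"
        by (simp add: t_def)
      ultimately show ?thesis
        by (intro mult_right_mono) (linarith, simp_all)
    qed
    finally show ?thesis .
  qed
  have "0 \<le> ?c"
    using k C eps c by (auto simp: c3_def intro!: add_nonneg_nonneg mult_nonneg_nonneg)
  then have "orth_level W \<le> (mat_norm2 (mat_inv H))\<^sup>2 * ?c"
    using main mat_inv_inverse[OF Bh_invertible upper_bidiag_carrier]
    by (intro orth_level_le_inverse[OF Wc Hc]) (simp_all add: H_def)
  then show ?thesis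
    by (simp add: W_def H_def V_def U_def)
qed

end

theorem theorem3p4:
  fixes k :: nat and C :: real
  assumes "1 \<le> k" and "0 < C"
  shows "\<exists>K>0. \<forall>(c1 :: nat \<Rightarrow> nat \<Rightarrow> real) (c2 :: nat \<Rightarrow> nat \<Rightarrow> real).
    (\<forall>a b. 1 \<le> c1 a b \<and> 1 \<le> c2 a b) \<longrightarrow>
    (\<forall>m n p. \<exists>eps0>0. \<forall>eps A L Q R u v uh \<alpha> \<beta> \<alpha>h \<beta>h.
      0 < eps \<longrightarrow> eps \<le> eps0 \<longrightarrow>
      computed_jbd C c1 c2 m n p k eps A L Q R u v uh \<alpha> \<beta> \<alpha>h \<beta>h \<longrightarrow>
      orth_level (first_cols p k uh)
        \<le> (mat_norm2 (mat_inv (upper_bidiag k \<alpha>h \<beta>h)))\<^sup>2 *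
          (orth_level (first_cols (m + p) k v) + 2 * orth_level (first_cols m (k + 1) u)
            + K * (c3 c1 c2 m n p * eps)))"
proof (rule exI[of _ "22 * real k * C"], intro conjI allI impI)
  show "0 < 22 * real k * C"
    using assms by simp
  fix c1 c2 :: "nat \<Rightarrow> nat \<Rightarrow> real" and m n p :: nat
  assume c: "\<forall>a b. 1 \<le> c1 a b \<and> 1 \<le> c2 a b"
  \<comment> \<open>Chosen so that the bound \<open>16 k C c3 eps\<close> for the norm of the residual is at most \<open>1\<close>.\<close>
  define eps0 where "eps0 = 1 / (16 * real k * (C * c3 c1 c2 m n p))"
  have c3: "0 < c3 c1 c2 m n p"
    using c[rule_format, of m n] c[rule_format, of p n] by (simp add: c3_def)
  then have pos: "0 < 16 * real k * (C * c3 c1 c2 m n p)"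
    using assms by simp
  show "\<exists>eps0>0. \<forall>eps A L Q R u v uh \<alpha> \<beta> \<alpha>h \<beta>h.
      0 < eps \<longrightarrow> eps \<le> eps0 \<longrightarrow>
      computed_jbd C c1 c2 m n p k eps A L Q R u v uh \<alpha> \<beta> \<alpha>h \<beta>h \<longrightarrow>
      orth_level (first_cols p k uh)
        \<le> (mat_norm2 (mat_inv (upper_bidiag k \<alpha>h \<beta>h)))\<^sup>2 *
          (orth_level (first_cols (m + p) k v) + 2 * orth_level (first_cols m (k + 1) u)
            + 22 * real k * C * (c3 c1 c2 m n p * eps))"
  proof (rule exI[of _ eps0], intro conjI allI impI)
    show "0 < eps0"
      using pos by (simp add: eps0_def)
    fix eps A L Q R u v uh \<alpha> \<beta> \<alpha>h \<beta>h
    assume "0 < eps" and "eps \<le> eps0"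
      and jbd: "computed_jbd C c1 c2 m n p k eps A L Q R u v uh \<alpha> \<beta> \<alpha>h \<beta>h"
    have "16 * real k * (C * (c3 c1 c2 m n p * eps)) \<le> 1"
      using \<open>eps \<le> eps0\<close> pos by (simp add: eps0_def pos_le_divide_eq mult_ac)
    from computed_jbd.orth_level_uh_le[OF jbd assms \<open>0 < eps\<close> _ _ this]
    show "orth_level (first_cols p k uh)
        \<le> (mat_norm2 (mat_inv (upper_bidiag k \<alpha>h \<beta>h)))\<^sup>2 *
          (orth_level (first_cols (m + p) k v) + 2 * orth_level (first_cols m (k + 1) u)
            + 22 * real k * C * (c3 c1 c2 m n p * eps))"
      using c by simp
  qed
qed

end
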